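(* For any quantum Boolean function $A\in M_2(\mathbb C)^{\otimes n}$ and any $\epsilon>0$ small enough, there exists a quantum Boolean function $C\in M_2(\mathbb C)^{\otimes n}$ which is a $k$-junta, with $\|A-C\|_2\le\epsilon$ and $$k\le 2^{\frac{270\operatorname{Inf}^2(A)}{\epsilon^2}}\;\frac{\operatorname{Inf}^1(A)^6}{\operatorname{Inf}^2(A)^5}.$$
   Context: $M_2(\mathbb{C})^{\otimes n}\cong M_{2^n}(\mathbb{C})$ is the algebra of operators on $n$ qubits, with trace $\operatorname{tr}$ and identity $\mathbf 1$. $A\in M_2(\mathbb{C})^{\otimes n}$ is a quantum Boolean function if $A=A^*$ and $A^2=\mathbf 1$. Normalized Schatten norm: $\|A\|_p=(2^{-n}\operatorname{tr}|A|^p)^{1/p}$. For $1\le j\le n$, $d_j=\mathbb I^{\otimes(j-1)}\otimes(\mathbb I-\tfrac12\operatorname{tr}(\cdot)\mathbf 1)\otimes\mathbb I^{\otimes(n-j)}$ ($\mathbb I$ the identity map on $M_2(\mathbb C)$), $\operatorname{Inf}^p_j(A)=\|d_jA\|_p^p$ and $\operatorname{Inf}^p(A)=\sum_{j=1}^n\operatorname{Inf}_j^p(A)$. With $\sigma_0=\mathbf 1,\sigma_1,\sigma_2,\sigma_3$ the Pauli matrices and $\sigma_s=\sigma_{s_1}\otimes\cdots\otimes\sigma_{s_n}$ for $s\in\{0,1,2,3\}^n$, write $A=\sum_s\widehat A_s\sigma_s$; $\operatorname{supp}(s)=\{j:s_j\ne0\}$ and $\operatorname{supp}(A)=\bigcup_{s:\widehat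 A_s\neq0}\operatorname{supp}(s)$. An operator $A$ is a $k$-junta if $|\operatorname{supp}(A)|\le k$. *)

theory Defs
  imports Complex_Main "Jordan_Normal_Form.Schur_Decomposition"
begin

text \<open>
  The algebra of operators on \<open>n\<close> qubits is \<open>carrier_mat (2 ^ n) (2 ^ n)\<close> over the complex numbers.
  A row or column index of a tensor product on \<open>M\<^sub>a \<otimes> M\<^sub>b\<close> is \<open>i * b + k\<close> with \<open>i < a\<close>, \<open>k < b\<close>, so the
  first tensor factor carries the most significant part of the index. Tensor factors (qubits) are
  numbered \<open>1, \<dots>, n\<close>.
\<close>

definition mtrace :: "complex mat \<Rightarrow> complex" where
  "mtrace A = (\<Sum>i<dim_row A. A $$ (i, i))"

definition msum :: "nat \<Rightarrow> ('b \<Rightarrow> complex mat) \<Rightarrow> 'b set \<Rightarrow> complex mat" where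
  "msum d f S = mat d d (\<lambda>ij. \<Sum>s\<in>S. f s $$ ij)"

definition kron :: "complex mat \<Rightarrow> complex mat \<Rightarrow> complex mat" where
  "kron A B = mat (dim_row A * dim_row B) (dim_col A * dim_col B)
     (\<lambda>(r, c). A $$ (r div dim_row B, c div dim_col B) * B $$ (r mod dim_row B, c mod dim_col B))"

definition quantum_boolean :: "nat \<Rightarrow> complex mat \<Rightarrow> bool" where
  "quantum_boolean n A \<longleftrightarrow>
     A \<in> carrier_mat (2 ^ n) (2 ^ n) \<and> mat_adjoint A = A \<and> A * A = 1\<^sub>m (2 ^ n)"

text \<open>
  Real powers of a positive semidefinite matrix, by functional calculus: the result does not depend
  on the chosen unitary diagonalisation. Since \<open>0 powr p = 0\<close>, the kernel is preserved.
\<close>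

definition mat_powr :: "complex mat \<Rightarrow> real \<Rightarrow> complex mat" where
  "mat_powr P p = (let d = dim_row P in
     THE Q. \<exists>U e. U \<in> carrier_mat d d \<and> mat_adjoint U * U = 1\<^sub>m d \<and> (\<forall>i<d. 0 \<le> e i) \<and>
       P = U * mat_diag d (\<lambda>i. complex_of_real (e i)) * mat_adjoint U \<and>
       Q = U * mat_diag d (\<lambda>i. complex_of_real (e i powr p)) * mat_adjoint U)"

definition mat_abs :: "complex mat \<Rightarrow> complex mat" where
  "mat_abs A = mat_powr (mat_adjoint A * A) (1 / 2)"

definition schatten :: "nat \<Rightarrow> real \<Rightarrow> complex mat \<Rightarrow> real" where
  "schatten n p A = (Re (mtrace (mat_powr (mat_abs A) p)) / 2 ^ n) powr (1 / p)"

definition matrix_unit :: "nat \<Rightarrow> nat \<Rightarrow> nat \<Rightarrow> complex mat" where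
  "matrix_unit d i j = mat d d (\<lambda>(k, l). if k = i \<and> l = j then 1 else 0)"

text \<open>
  The tensor product of linear maps \<open>\<Phi>\<close> on \<open>M\<^sub>a\<close> and \<open>\<Psi>\<close> on \<open>M\<^sub>b\<close>: the linear extension of
  \<open>kron X Y \<mapsto> kron (\<Phi> X) (\<Psi> Y)\<close> from the basis of matrix units.
\<close>

definition map_tensor ::
  "nat \<Rightarrow> nat \<Rightarrow> (complex mat \<Rightarrow> complex mat) \<Rightarrow> (complex mat \<Rightarrow> complex mat) \<Rightarrow> complex mat \<Rightarrow> complex mat" where
  "map_tensor a b \<Phi> \<Psi> X = msum (a * b)
     (\<lambda>(i, j, k, l). X $$ (i * b + k, j * b + l) \<cdot>\<^sub>m
        kron (\<Phi> (matrix_unit a i j)) (\<Psi> (matrix_unit b k l)))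
     ({..<a} \<times> {..<a} \<times> {..<b} \<times> {..<b})"

definition qubit_diff :: "nat \<Rightarrow> nat \<Rightarrow> complex mat \<Rightarrow> complex mat" where
  "qubit_diff n j = map_tensor (2 ^ (j - 1)) (2 * 2 ^ (n - j)) (\<lambda>X. X)
     (map_tensor 2 (2 ^ (n - j)) (\<lambda>X. X - (mtrace X / 2) \<cdot>\<^sub>m 1\<^sub>m 2) (\<lambda>X. X))"

definition influence_at :: "nat \<Rightarrow> real \<Rightarrow> nat \<Rightarrow> complex mat \<Rightarrow> real" where
  "influence_at n p j A = schatten n p (qubit_diff n j A) powr p"

definition influence :: "nat \<Rightarrow> real \<Rightarrow> complex mat \<Rightarrow> real" where
  "influence n p A = (\<Sum>j=1..n. influence_at n p j A)"

definition pauli :: "nat \<Rightarrow> complex mat" where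
  "pauli k = (if k = 0 then mat_of_rows_list 2 [[1, 0], [0, 1]]
     else if k = 1 then mat_of_rows_list 2 [[0, 1], [1, 0]]
     else if k = 2 then mat_of_rows_list 2 [[0, - \<i>], [\<i>, 0]]
     else mat_of_rows_list 2 [[1, 0], [0, - 1]])"

definition pauli_indices :: "nat \<Rightarrow> nat list set" where
  "pauli_indices n = {s. length s = n \<and> set s \<subseteq> {0, 1, 2, 3}}"

definition pauli_tensor :: "nat list \<Rightarrow> complex mat" where
  "pauli_tensor s = foldr (\<lambda>k. kron (pauli k)) s (1\<^sub>m 1)"

text \<open>
  The coefficients of the expansion in the basis of Pauli strings; they are set to \<open>0\<close> off the index
  set, so that the function is uniquely determined.
\<close>

definition pauli_coeff :: "nat \<Rightarrow> complex mat \<Rightarrow> nat list \<Rightarrow> complex" where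
  "pauli_coeff n A = (THE c. A = msum (2 ^ n) (\<lambda>s. c s \<cdot>\<^sub>m pauli_tensor s) (pauli_indices n) \<and>
     (\<forall>s. s \<notin> pauli_indices n \<longrightarrow> c s = 0))"

definition index_supp :: "nat list \<Rightarrow> nat set" where
  "index_supp s = {j. 1 \<le> j \<and> j \<le> length s \<and> s ! (j - 1) \<noteq> 0}"

definition op_supp :: "nat \<Rightarrow> complex mat \<Rightarrow> nat set" where
  "op_supp n A = (\<Union>s\<in>{s \<in> pauli_indices n. pauli_coeff n A s \<noteq> 0}. index_supp s)"

definition junta :: "nat \<Rightarrow> nat \<Rightarrow> complex mat \<Rightarrow> bool" where
  "junta n k A \<longleftrightarrow> A \<in> carrier_mat (2 ^ n) (2 ^ n) \<and> card (op_supp n A) \<le> k"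

end

(*
The argument is Friedgut's. Let T be the set of qubits j with Inf^1_j(A) >= tau, and let B be the part
of the Pauli expansion of A supported in T. Strings of weight above d carry mass at most Inf^2(A)/d. A
string of weight at most d that leaves T is charged to some j outside T, and
  sum_{s_j /= 0} 16^{-|s|} A_s^2 <= ||d_j A||_1 ||d_j A||_2
follows by duality from the estimate ||F||_4^2 <= sum_s 16^{|s|} F_s^2. The latter is an (L2, L4)
hypercontractive inequality with a bad constant, so it only needs a multilinear Hoelder inequality for
the trace of four Hermitian matrices and an induction over the tensor factors; the constant 270 leaves
ample room for this. Rounding B to C = sgn B keeps the support in T, because C commutes with every
operator that commutes with B. Since tr(AC) = tr|B| >= tr(BA) and tr(BA) = tr(B^2), it costs only a
factor 2 in ||A - B||_2^2. The powers of Inf^1 and Inf^2 in the bound come from Inf^2(A) <= Inf^1(A); when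
2 Inf^2(A) <= eps^2, the choice T = {} suffices.
*)
theory Submission
  imports Defs "Jordan_Normal_Form.Spectral_Radius" "HOL-Analysis.L2_Norm"
begin

section \<open>Hermitian matrices and Schatten norms\<close>

text \<open>For a classical Boolean function the difference f - E_j f takes values in {-1, 0, 1}, so
  its 1-norm is the square of its 2-norm. The spectrum of d_j A is not so confined: for A = cos t (1
  x sigma_3) + sin t (sigma_1 x sigma_1) on two qubits the influences of the first qubit are |sin t|
  and (sin t)^2. Only Inf^2 \<le> Inf^1 survives, so both occur: the 1-norm selects the qubits, the
  2-norm controls the weight of strings.

  The second obstacle is that two operators rarely share an eigenbasis. Each estimate is made in an
  eigenbasis of one operator, where only the diagonal of the other enters, and
  \<open>hermitian_square_diag\<close> bounds that diagonal. Functions of Hermitian matrices are all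
  written as \<open>diag_conj\<close>; one lemma on intertwiners shows both that they do not depend
  on the diagonalisation and that sgn B commutes with whatever commutes with B.

  The target tail \<epsilon>^2/2 is split evenly: weight cutoff and threshold are chosen so that
  heavy and light strings contribute \<epsilon>^2/4 each.\<close>

lemma mat_adjoint_dim [simp]:
  "dim_row (mat_adjoint A) = dim_col A" "dim_col (mat_adjoint A) = dim_row A"
  unfolding mat_adjoint_def by auto

lemma mat_adjoint_carrier [simp]: "A \<in> carrier_mat n m \<Longrightarrow> mat_adjoint A \<in> carrier_mat m n"
  by (metis carrier_matD carrier_matI mat_adjoint_dim)

lemma mat_adjoint_index [simp]:
  "i < dim_col A \<Longrightarrow> j < dim_row A \<Longrightarrow> mat_adjoint A $$ (i, j) = cnj (A $$ (j, i))"
  by (simp add: mat_adjoint_def mat_of_rows_index)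

lemma mult_index:
  "A \<in> carrier_mat n m \<Longrightarrow> B \<in> carrier_mat m k \<Longrightarrow> i < n \<Longrightarrow> j < k \<Longrightarrow>
    (A * B) $$ (i, j) = (\<Sum>l<m. A $$ (i, l) * B $$ (l, j))"
  by (auto simp: scalar_prod_def atLeast0LessThan)

text \<open>Both facts serve as one rewrite system: \<open>mult_square[of _ n]\<close> normalises
  products of square matrices by associating to the right. The dimension has to be supplied because
  it does not occur in the equation.\<close>

lemma mult_square:
  assumes "A \<in> carrier_mat n n" "B \<in> carrier_mat n n"
  shows "A * B \<in> carrier_mat n n"
    "C \<in> carrier_mat n n \<Longrightarrow> A * B * C = A * (B * (C :: 'a :: semiring_0 mat))"
  using assms by (auto intro: assoc_mult_mat)

lemma mat_adjoint_mult:
  assumes A: "A \<in> carrier_mat n m" and B: "B \<in> carrier_mat m k"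
  shows "mat_adjoint (A * B) = mat_adjoint B * mat_adjoint (A :: complex mat)"
proof (rule eq_matI)
  fix i j assume "i < dim_row (mat_adjoint B * mat_adjoint A)" "j < dim_col (mat_adjoint B * mat_adjoint A)"
  hence i: "i < k" and j: "j < n" using A B by auto
  have "mat_adjoint (A * B) $$ (i, j) = cnj ((A * B) $$ (j, i))" using A B i j by simp
  also have "\<dots> = (\<Sum>l<m. cnj (A $$ (j, l)) * cnj (B $$ (l, i)))"
    by (simp add: mult_index[OF A B j i])
  also have "\<dots> = (\<Sum>l<m. mat_adjoint B $$ (i, l) * mat_adjoint A $$ (l, j))"
    using A B i j by (intro sum.cong) (auto simp: mult.commute)
  also have "\<dots> = (mat_adjoint B * mat_adjoint A) $$ (i, j)"
    by (rule mult_index[symmetric, OF mat_adjoint_carrier[OF B] mat_adjoint_carrier[OF A] i j])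
  finally show "mat_adjoint (A * B) $$ (i, j) = (mat_adjoint B * mat_adjoint A) $$ (i, j)" .
qed (use A B in auto)

lemma mat_adjoint_adjoint [simp]: "mat_adjoint (mat_adjoint A) = (A :: complex mat)"
  by (rule eq_matI) auto

lemma mat_adjoint_minus:
  "A \<in> carrier_mat n m \<Longrightarrow> B \<in> carrier_mat n m \<Longrightarrow>
    mat_adjoint (A - B) = mat_adjoint A - mat_adjoint (B :: complex mat)"
  by (rule eq_matI) auto

lemma hermitian_index:
  "A \<in> carrier_mat n n \<Longrightarrow> mat_adjoint A = A \<Longrightarrow> i < n \<Longrightarrow> j < n \<Longrightarrow> A $$ (j, i) = cnj (A $$ (i, j))"
  by (metis carrier_matD mat_adjoint_index)

section \<open>Unitary matrices and functional calculus in an eigenbasis\<close>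

definition unitary_mat :: "nat \<Rightarrow> complex mat \<Rightarrow> bool" where
  "unitary_mat n U \<longleftrightarrow> U \<in> carrier_mat n n \<and> mat_adjoint U * U = 1\<^sub>m n"

lemma unitary_matD:
  assumes "unitary_mat n U"
  shows "U \<in> carrier_mat n n" "mat_adjoint U \<in> carrier_mat n n"
    "mat_adjoint U * U = 1\<^sub>m n" "U * mat_adjoint U = 1\<^sub>m n"
proof -
  show U: "U \<in> carrier_mat n n" and U': "mat_adjoint U * U = 1\<^sub>m n"
    using assms by (auto simp: unitary_mat_def)
  show "mat_adjoint U \<in> carrier_mat n n" using U by simp
  show "U * mat_adjoint U = 1\<^sub>m n"
    by (rule mat_mult_left_right_inverse[OF _ U U']) (use U in simp)
qed

lemma unitary_mat_cancel:
  assumes "unitary_mat n U" "M \<in> carrier_mat n m"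
  shows "mat_adjoint U * (U * M) = M" "U * (mat_adjoint U * M) = M"
proof -
  note U = unitary_matD[OF assms(1)]
  have "mat_adjoint U * (U * M) = (mat_adjoint U * U) * M"
    by (rule assoc_mult_mat[symmetric]) (use U assms in auto)
  thus "mat_adjoint U * (U * M) = M" using U assms by simp
  have "U * (mat_adjoint U * M) = (U * mat_adjoint U) * M"
    by (rule assoc_mult_mat[symmetric]) (use U assms in auto)
  thus "U * (mat_adjoint U * M) = M" using U assms by simp
qed

lemma unitary_mat_mult:
  assumes "unitary_mat n U" "unitary_mat n V"
  shows "unitary_mat n (U * V)"
proof -
  note U = unitary_matD[OF assms(1)] and V = unitary_matD[OF assms(2)]
  have "mat_adjoint (U * V) * (U * V) = mat_adjoint V * (mat_adjoint U * (U * V))"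
    using U V by (simp add: mat_adjoint_mult[of _ n n _ n] mult_square[of _ n])
  also have "\<dots> = 1\<^sub>m n" using unitary_mat_cancel[OF assms(1) V(1)] V by simp
  finally show ?thesis using U V by (simp add: unitary_mat_def)
qed

text \<open>With \<open>U\<close> unitary, \<open>f\<close> lists the values on the eigenvectors,
  which are the columns of \<open>U\<close>. Products, adjoints and traces then become pointwise
  operations on \<open>f\<close>.\<close>

definition diag_conj :: "nat \<Rightarrow> complex mat \<Rightarrow> (nat \<Rightarrow> complex) \<Rightarrow> complex mat" where
  "diag_conj n U f = U * mat_diag n f * mat_adjoint U"

lemma diag_conj_carrier [simp]: "U \<in> carrier_mat n n \<Longrightarrow> diag_conj n U f \<in> carrier_mat n n"
  by (auto simp: diag_conj_def mat_diag_def)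

lemma diag_conj_dim [simp]:
  "dim_row (diag_conj n U f) = dim_row U" "dim_col (diag_conj n U f) = dim_row U"
  by (auto simp: diag_conj_def)

lemma diag_conj_index:
  assumes U: "U \<in> carrier_mat n n" and "i < n" "j < n"
  shows "diag_conj n U f $$ (i, j) = (\<Sum>k<n. U $$ (i, k) * f k * cnj (U $$ (j, k)))"
proof -
  have "U * mat_diag n f \<in> carrier_mat n n" using U by simp
  thus ?thesis unfolding diag_conj_def
    using mult_index[of "U * mat_diag n f" n n "mat_adjoint U" n i j] assms
    by (simp add: mat_diag_mult_right[OF U])
qed

lemma diag_conj_mult:
  assumes "unitary_mat n U"
  shows "diag_conj n U f * diag_conj n U g = diag_conj n U (\<lambda>i. f i * g i)"
proof -
  note U = unitary_matD[OF assms]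
  have "diag_conj n U f * diag_conj n U g
      = U * (mat_diag n f * (mat_adjoint U * (U * (mat_diag n g * mat_adjoint U))))"
    unfolding diag_conj_def using U(1,2)
    by (simp add: mult_square[of _ n])
  also have "\<dots> = U * (mat_diag n f * (mat_diag n g * mat_adjoint U))"
    by (subst unitary_mat_cancel(1)[OF assms, of _ n]) (use U in \<open>auto intro!: mult_carrier_mat\<close>)
  also have "\<dots> = U * ((mat_diag n f * mat_diag n g) * mat_adjoint U)"
    using U(1,2) by (simp only: mult_square[of _ n] mat_diag_dim)
  finally show ?thesis
    unfolding diag_conj_def using U(1,2) by (simp add: mult_square[of _ n])
qed

lemma diag_conj_adjoint: "U \<in> carrier_mat n n \<Longrightarrow>
   mat_adjoint (diag_conj n U f) = diag_conj n U (\<lambda>i. cnj (f i))"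
  by (rule eq_matI) (auto simp: diag_conj_index mult_ac intro!: sum.cong)

lemma diag_conj_one: "unitary_mat n U \<Longrightarrow> diag_conj n U (\<lambda>_. 1) = 1\<^sub>m n"
  using unitary_matD[of n U] by (simp add: diag_conj_def)

lemma diag_conj_eigen:
  assumes "unitary_mat n U"
  shows "mat_adjoint U * diag_conj n U f = mat_diag n f * mat_adjoint U"
    "diag_conj n U f * U = U * mat_diag n f"
proof -
  note U = unitary_matD[OF assms]
  have "mat_adjoint U * diag_conj n U f = mat_adjoint U * (U * (mat_diag n f * mat_adjoint U))"
    unfolding diag_conj_def using U(1,2) by (simp add: mult_square[of _ n])
  also have "\<dots> = mat_diag n f * mat_adjoint U"
    by (rule unitary_mat_cancel(1)[OF assms, of _ n]) (use U in \<open>auto intro!: mult_carrier_mat\<close>)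
  finally show "mat_adjoint U * diag_conj n U f = mat_diag n f * mat_adjoint U" .
  show "diag_conj n U f * U = U * mat_diag n f"
    unfolding diag_conj_def using U by (simp add: mult_square[of _ n] right_mult_one_mat[of _ n n])
qed

text \<open>In the two eigenbases the hypothesis reads
  \<open>K $$ (i, j) * h (e j) = h (e' i) * K $$ (i, j)\<close>, so an entry of \<open>K\<close>
  vanishes unless \<open>e j = e' i\<close>; then every function \<open>g\<close> passes through
  \<open>K\<close> as well. The injection \<open>h\<close> is there because the eigenvalues are real
  and the matrices complex.\<close>

lemma diag_conj_intertwine:
  fixes e e' :: "nat \<Rightarrow> 'a" and h g :: "'a \<Rightarrow> complex"
  assumes U: "unitary_mat n U" and V: "unitary_mat n V" and W: "W \<in> carrier_mat n n"
    and h: "inj h"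
    and eq: "W * diag_conj n U (\<lambda>i. h (e i)) = diag_conj n V (\<lambda>i. h (e' i)) * W"
  shows "W * diag_conj n U (\<lambda>i. g (e i)) = diag_conj n V (\<lambda>i. g (e' i)) * W"
proof -
  note U' = unitary_matD[OF U] and V' = unitary_matD[OF V]
  define K where "K = mat_adjoint V * W * U"
  have K: "K \<in> carrier_mat n n" unfolding K_def using U' V' W by auto
  have left: "K * mat_diag n f = mat_adjoint V * (W * diag_conj n U f) * U" for f
    unfolding K_def using U' V' W diag_conj_eigen(2)[OF U, of f]
    by (simp add: mult_square[of _ n])
  have right: "mat_diag n f * K = mat_adjoint V * (diag_conj n V f * W) * U" for f
  proof -
    have "mat_diag n f * K = mat_diag n f * mat_adjoint V * W * U"
      unfolding K_def using U' V' W by (simp add: mult_square[of _ n])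
    also have "\<dots> = mat_adjoint V * (diag_conj n V f * W) * U"
      unfolding diag_conj_eigen(1)[OF V, symmetric] using U' V' W
      by (simp add: mult_square[of _ n])
    finally show ?thesis .
  qed
  have KD: "K * mat_diag n (\<lambda>i. h (e i)) = mat_diag n (\<lambda>i. h (e' i)) * K"
    unfolding left right eq ..
  have "K * mat_diag n (\<lambda>i. g (e i)) = mat_diag n (\<lambda>i. g (e' i)) * K"
  proof (rule eq_matI)
    fix i j assume "i < dim_row (mat_diag n (\<lambda>i. g (e' i)) * K)" "j < dim_col (mat_diag n (\<lambda>i. g (e' i)) * K)"
    hence ij: "i < n" "j < n" using K by (auto simp: mat_diag_def)
    have "K $$ (i, j) * h (e j) = h (e' i) * K $$ (i, j)"
      using arg_cong[OF KD, of "\<lambda>M. M $$ (i, j)"] ij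
      by (simp add: mat_diag_mult_left[OF K] mat_diag_mult_right[OF K])
    hence "K $$ (i, j) = 0 \<or> e j = e' i" using injD[OF h] by auto
    thus "(K * mat_diag n (\<lambda>i. g (e i))) $$ (i, j) = (mat_diag n (\<lambda>i. g (e' i)) * K) $$ (i, j)"
      using ij by (auto simp: mat_diag_mult_left[OF K] mat_diag_mult_right[OF K])
  qed (use K in \<open>auto simp: mat_diag_def\<close>)
  hence eq': "mat_adjoint V * (W * diag_conj n U (\<lambda>i. g (e i))) * U
      = mat_adjoint V * (diag_conj n V (\<lambda>i. g (e' i)) * W) * U"
    unfolding left right .
  have strip: "V * (mat_adjoint V * M * U) * mat_adjoint U = M" if M: "M \<in> carrier_mat n n" for M
  proof -
    have "V * (mat_adjoint V * M * U) * mat_adjoint U = V * (mat_adjoint V * (M * (U * mat_adjoint U)))"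
      using U'(1,2) V'(1,2) M by (simp add: mult_square[of _ n])
    thus ?thesis using U' M unitary_mat_cancel(2)[OF V M] by simp
  qed
  have "W * diag_conj n U (\<lambda>i. g (e i)) \<in> carrier_mat n n" "diag_conj n V (\<lambda>i. g (e' i)) * W \<in> carrier_mat n n"
    using U' V' W by (auto intro!: mult_square)
  from this[THEN strip] show ?thesis unfolding eq' by simp
qed

text \<open>The intertwiner is the identity here. This independence of the diagonalisation is what
  the \<open>THE\<close> in \<open>mat_powr\<close> rests on.\<close>

lemma diag_conj_unique:
  fixes e e' :: "nat \<Rightarrow> 'a" and h g :: "'a \<Rightarrow> complex"
  assumes U: "unitary_mat n U" and V: "unitary_mat n V" and h: "inj h"
    and eq: "diag_conj n U (\<lambda>i. h (e i)) = diag_conj n V (\<lambda>i. h (e' i))"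
  shows "diag_conj n U (\<lambda>i. g (e i)) = diag_conj n V (\<lambda>i. g (e' i))"
proof -
  note U' = unitary_matD[OF U] and V' = unitary_matD[OF V]
  show ?thesis
    using diag_conj_intertwine[OF U V one_carrier_mat h, of e e' g] eq U'(1) V'(1)
    by (simp add: left_mult_one_mat[of _ n n] right_mult_one_mat[of _ n n])
qed

section \<open>The spectral theorem for Hermitian matrices\<close>

lemma exists_unitary_first_column:
  assumes v: "v \<in> carrier_vec n" and v0: "v \<noteq> 0\<^sub>v n"
  shows "\<exists>W c. unitary_mat n W \<and> (\<forall>i<n. W $$ (i, 0) = c * v $ i)"
proof -
  have n: "n \<noteq> 0" using v v0 by (metis eq_vecI carrier_vecD index_zero_vec(2) less_nat_zero_code)
  interpret cof_vec_space n "TYPE(complex)" .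
  define b where "b = basis_completion v"
  define ws where "ws = gram_schmidt n b"
  from basis_completion[OF v v0, folded b_def]
  have dist_b: "distinct b" and indep: "\<not> lin_dep (set b)" and b: "set b \<subseteq> carrier_vec n"
    and hdb: "hd b = v" and len_b: "length b = n" by auto
  from hdb len_b n obtain vs where bv: "b = v # vs" by (cases b, auto)
  from gram_schmidt_result[OF b dist_b indep refl, folded ws_def]
  have ws: "set ws \<subseteq> carrier_vec n" "corthogonal ws" "length ws = n"
    by (auto simp: len_b)
  \<comment> \<open>Gram-Schmidt leaves its first vector alone, so normalising the columns changes
    \<open>v\<close> only by the scalar \<open>c\<close>.\<close>
  from gram_schmidt_hd[OF v, of vs, folded bv] have hdws: "hd ws = v" unfolding ws_def .
  have wsc: "ws ! i \<in> carrier_vec n" if "i < n" for i using ws that by auto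
  define q where "q i j = (\<Sum>k<n. cnj (ws ! i $ k) * ws ! j $ k)" for i j
  have q: "ws ! j \<bullet>c ws ! i = q i j" if "i < n" "j < n" for i j
    using wsc[OF that(1)] wsc[OF that(2)]
    by (auto simp: q_def scalar_prod_def atLeast0LessThan mult.commute intro!: sum.cong)
  have q0: "q i j = 0 \<longleftrightarrow> i \<noteq> j" if "i < n" "j < n" for i j
    using corthogonalD[OF ws(2), of j i] q[OF that] that ws(3) by auto
  define r where "r i = (\<Sum>k<n. (cmod (ws ! i $ k))\<^sup>2)" for i
  have qr: "q i i = of_real (r i)" for i
    unfolding q_def r_def by (simp add: complex_norm_square[symmetric] mult.commute[of "cnj _"] del: of_real_power)
  have r0: "r i > 0" if "i < n" for i
  proof -
    have "r i \<ge> 0" unfolding r_def by (intro sum_nonneg) auto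
    moreover have "r i \<noteq> 0" using q0[OF that that] qr[of i] by auto
    ultimately show ?thesis by auto
  qed
  define W where "W = mat n n (\<lambda>(k, i). of_real (1 / sqrt (r i)) * ws ! i $ k)"
  have W: "W \<in> carrier_mat n n" by (simp add: W_def)
  have "mat_adjoint W * W = 1\<^sub>m n"
  proof (rule eq_matI)
    fix i j assume "i < dim_row (1\<^sub>m n)" "j < dim_col (1\<^sub>m n)"
    hence ij: "i < n" "j < n" by auto
    have "(mat_adjoint W * W) $$ (i, j) = (\<Sum>k<n. mat_adjoint W $$ (i, k) * W $$ (k, j))"
      by (rule mult_index) (use W ij in auto)
    also have "\<dots> = (\<Sum>k<n. of_real (1 / sqrt (r i)) * of_real (1 / sqrt (r j)) * (cnj (ws ! i $ k) * ws ! j $ k))"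
      using W ij by (intro sum.cong) (auto simp: W_def)
    also have "\<dots> = of_real (1 / sqrt (r i)) * of_real (1 / sqrt (r j)) * q i j"
      by (simp add: q_def sum_distrib_left)
    also have "\<dots> = (if i = j then 1 else 0)"
    proof (cases "i = j")
      case True
      have "1 / sqrt (r i) * (1 / sqrt (r i)) * r i = 1" using r0[OF ij(1)] by simp
      hence "of_real (1 / sqrt (r i) * (1 / sqrt (r i)) * r i) = (1::complex)" by simp
      thus ?thesis using True unfolding qr[symmetric] of_real_mult by (simp add: qr)
    qed (use q0[OF ij] in auto)
    finally show "(mat_adjoint W * W) $$ (i, j) = 1\<^sub>m n $$ (i, j)" using ij by simp
  qed (use W in auto)
  moreover have "ws ! 0 = v" using hdws ws(3) n by (metis hd_conv_nth length_0_conv)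
  ultimately show ?thesis using W n
    by (intro exI[of _ W] exI[of _ "of_real (1 / sqrt (r 0))"]) (auto simp: unitary_mat_def W_def)
qed

text \<open>Deflation: a unitary whose first column is an eigenvector clears the first column below
  the diagonal, Hermiticity clears the first row, and the remaining block is diagonalised by
  induction.\<close>

lemma hermitian_diagonalization:
  assumes "A \<in> carrier_mat n n" "mat_adjoint A = A"
  shows "\<exists>U e. unitary_mat n U \<and> A = diag_conj n U (\<lambda>i. complex_of_real (e i))"
  using assms
proof (induction n arbitrary: A)
  case 0
  show ?case
    by (rule exI[of _ "1\<^sub>m 0"], rule exI[of _ "\<lambda>_. 0"]) (use 0 in \<open>auto simp: unitary_mat_def diag_conj_def\<close>)
next
  case (Suc m)
  note A = Suc.prems(1)
  obtain ev where "eigenvalue A ev"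
    using spectrum_non_empty[OF A] by (auto simp: spectrum_def)
  then obtain v where "eigenvector A v ev" by (auto simp: eigenvalue_def)
  hence v: "v \<in> carrier_vec (Suc m)" "v \<noteq> 0\<^sub>v (Suc m)" "A *\<^sub>v v = ev \<cdot>\<^sub>v v"
    using A by (auto simp: eigenvector_def)
  obtain W c where W: "unitary_mat (Suc m) W" and Wc: "\<And>i. i < Suc m \<Longrightarrow> W $$ (i, 0) = c * v $ i"
    using exists_unitary_first_column[OF v(1,2)] by auto
  note W' = unitary_matD[OF W]
  define A' where "A' = mat_adjoint W * (A * W)"
  have A': "A' \<in> carrier_mat (Suc m) (Suc m)" using A W' by (simp add: A'_def mult_square[of _ "Suc m"])
  have A'h: "mat_adjoint A' = A'" unfolding A'_def using A W' Suc.prems(2)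
    by (simp add: mat_adjoint_mult[of _ "Suc m" "Suc m" _ "Suc m"] mult_square[of _ "Suc m"])
  have AW0: "(A * W) $$ (i, 0) = ev * W $$ (i, 0)" if i: "i < Suc m" for i
  proof -
    have "(A * W) $$ (i, 0) = (\<Sum>l<Suc m. A $$ (i, l) * (c * v $ l))"
      using mult_index[OF A W'(1) i, of 0] by (simp add: Wc)
    also have "\<dots> = c * (\<Sum>l<Suc m. A $$ (i, l) * v $ l)"
      unfolding sum_distrib_left by (simp only: mult_ac)
    also have "(\<Sum>l<Suc m. A $$ (i, l) * v $ l) = (A *\<^sub>v v) $ i"
      using A v(1) i by (simp add: scalar_prod_def atLeast0LessThan)
    finally show ?thesis using v i by (simp add: Wc)
  qed
  have A'0: "A' $$ (i, 0) = (if i = 0 then ev else 0)" if i: "i < Suc m" for i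
  proof -
    have "A' $$ (i, 0) = (\<Sum>l<Suc m. mat_adjoint W $$ (i, l) * (A * W) $$ (l, 0))"
      unfolding A'_def by (rule mult_index) (use A W' i in auto)
    also have "\<dots> = ev * (\<Sum>l<Suc m. mat_adjoint W $$ (i, l) * W $$ (l, 0))"
      unfolding sum_distrib_left by (intro sum.cong) (auto simp: AW0 mult_ac)
    also have "(\<Sum>l<Suc m. mat_adjoint W $$ (i, l) * W $$ (l, 0)) = (mat_adjoint W * W) $$ (i, 0)"
      by (rule mult_index[symmetric]) (use W' i in auto)
    finally show ?thesis using W' i by simp
  qed
  have A'1: "A' $$ (0, i) = (if i = 0 then cnj ev else 0)" if i: "i < Suc m" for i
    using hermitian_index[OF A' A'h i, of 0] A'0[OF i] by simp
  \<comment> \<open>The corner entry of \<open>A'\<close> is \<open>ev\<close> when read in the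
    first column and \<open>cnj ev\<close> when read in the first row, hence real.\<close>
  define er where "er = Re ev"
  have evr: "complex_of_real er = ev" using A'0[of 0] A'1[of 0] by (simp add: complex_eq_iff er_def)
  define A3 where "A3 = mat m m (\<lambda>(i, j). A' $$ (Suc i, Suc j))"
  have A3: "A3 \<in> carrier_mat m m" by (simp add: A3_def)
  have "mat_adjoint A3 = A3"
    by (rule eq_matI) (auto simp: A3_def hermitian_index[OF A' A'h, symmetric])
  from Suc.IH[OF A3 this] obtain V e where V: "unitary_mat m V"
    and A3e: "A3 = diag_conj m V (\<lambda>i. complex_of_real (e i))" by auto
  note V' = unitary_matD[OF V]
  \<comment> \<open>The block sum of the 1 x 1 identity and \<open>V\<close>, with the indices of
    \<open>V\<close> shifted by one.\<close>
  define V1 where "V1 = mat (Suc m) (Suc m)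
    (\<lambda>(i, j). if i = 0 \<or> j = 0 then (if i = j then 1 else 0) else V $$ (i - 1, j - 1))"
  define e1 where "e1 i = (if i = 0 then er else e (i - 1))" for i
  have V1: "V1 \<in> carrier_mat (Suc m) (Suc m)" by (simp add: V1_def)
  have "mat_adjoint V1 * V1 = 1\<^sub>m (Suc m)"
  proof (rule eq_matI)
    fix i j assume "i < dim_row (1\<^sub>m (Suc m))" "j < dim_col (1\<^sub>m (Suc m))"
    hence ij: "i < Suc m" "j < Suc m" by auto
    have "(mat_adjoint V1 * V1) $$ (i, j) = (\<Sum>k<Suc m. mat_adjoint V1 $$ (i, k) * V1 $$ (k, j))"
      by (rule mult_index) (use V1 ij in auto)
    also have "\<dots> = (\<Sum>k<Suc m. cnj (V1 $$ (k, i)) * V1 $$ (k, j))"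
      using V1 ij by (intro sum.cong) auto
    also have "\<dots> = 1\<^sub>m (Suc m) $$ (i, j)"
    proof (cases "i = 0 \<or> j = 0")
      case True
      thus ?thesis using ij by (auto simp: V1_def sum.lessThan_Suc_shift simp del: sum.lessThan_Suc)
    next
      case False
      then obtain i' j' where [simp]: "i = Suc i'" "j = Suc j'" by (metis not0_implies_Suc)
      have "(\<Sum>k<m. cnj (V $$ (k, i')) * V $$ (k, j')) = (mat_adjoint V * V) $$ (i', j')"
        using mult_index[OF V'(2,1), of i' j'] V' ij by simp
      thus ?thesis using V' ij by (simp add: V1_def sum.lessThan_Suc_shift del: sum.lessThan_Suc)
    qed
    finally show "(mat_adjoint V1 * V1) $$ (i, j) = 1\<^sub>m (Suc m) $$ (i, j)" .
  qed (use V1 in auto)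
  hence V1u: "unitary_mat (Suc m) V1" using V1 by (simp add: unitary_mat_def)
  have A'e: "A' = diag_conj (Suc m) V1 (\<lambda>i. complex_of_real (e1 i))"
  proof (rule eq_matI)
    fix i j assume "i < dim_row (diag_conj (Suc m) V1 (\<lambda>i. complex_of_real (e1 i)))"
      "j < dim_col (diag_conj (Suc m) V1 (\<lambda>i. complex_of_real (e1 i)))"
    hence ij: "i < Suc m" "j < Suc m" using V1 by (auto simp: diag_conj_def)
    show "A' $$ (i, j) = diag_conj (Suc m) V1 (\<lambda>i. complex_of_real (e1 i)) $$ (i, j)"
    proof (cases "i = 0 \<or> j = 0")
      case True
      have "cnj ev = ev" by (simp add: evr[symmetric])
      thus ?thesis unfolding diag_conj_index[OF V1 ij] using ij True A'0[OF ij(1)] A'1[OF ij(2)] evr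
        by (auto simp: V1_def e1_def sum.lessThan_Suc_shift simp del: sum.lessThan_Suc)
    next
      case False
      then obtain i' j' where [simp]: "i = Suc i'" "j = Suc j'" by (metis not0_implies_Suc)
      have "A' $$ (i, j) = A3 $$ (i', j')" using ij by (simp add: A3_def)
      thus ?thesis unfolding diag_conj_index[OF V1 ij] A3e using ij
        by (simp add: V1_def e1_def sum.lessThan_Suc_shift diag_conj_index[OF V'(1)] del: sum.lessThan_Suc)
    qed
  qed (use A' V1 in \<open>auto simp: diag_conj_def\<close>)
  have "A = W * A' * mat_adjoint W"
  proof -
    have "W * A' * mat_adjoint W = W * (mat_adjoint W * (A * (W * mat_adjoint W)))"
      unfolding A'_def using A W'(1,2) by (simp add: mult_square[of _ "Suc m"])
    also have "\<dots> = A" using W'(4) A unitary_mat_cancel(2)[OF W A] by simp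
    finally show ?thesis ..
  qed
  also have "\<dots> = diag_conj (Suc m) (W * V1) (\<lambda>i. complex_of_real (e1 i))"
    unfolding A'e diag_conj_def using W'(1,2) V1
    by (simp add: mat_adjoint_mult[of _ "Suc m" "Suc m" _ "Suc m"] mult_square[of _ "Suc m"])
  finally show ?case using unitary_mat_mult[OF W V1u] by blast
qed

section \<open>Traces and Schatten norms in an eigenbasis\<close>

lemma mtrace_mult:
  assumes "A \<in> carrier_mat n m" "B \<in> carrier_mat m n"
  shows "mtrace (A * B) = (\<Sum>i<n. \<Sum>j<m. A $$ (i, j) * B $$ (j, i))"
  using assms unfolding mtrace_def by (auto simp: mult_index[OF assms] simp del: index_mult_mat(1) intro!: sum.cong)

lemma mtrace_comm:
  assumes "A \<in> carrier_mat n m" "B \<in> carrier_mat m n"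
  shows "mtrace (A * B) = mtrace (B * A)"
  unfolding mtrace_mult[OF assms] mtrace_mult[OF assms(2,1)]
  by (subst sum.swap) (simp add: mult.commute)

lemma mtrace_minus:
  "A \<in> carrier_mat n n \<Longrightarrow> B \<in> carrier_mat n n \<Longrightarrow> mtrace (A - B) = mtrace A - mtrace B"
  by (simp add: mtrace_def sum_subtractf)

lemma mtrace_smult: "A \<in> carrier_mat n n \<Longrightarrow> mtrace (c \<cdot>\<^sub>m A) = c * mtrace A"
  by (simp add: mtrace_def sum_distrib_left)

lemma mtrace_one: "mtrace (1\<^sub>m n) = of_nat n"
  by (simp add: mtrace_def)

text \<open>This is how noncommuting operators are handled: pairing \<open>M\<close> with a
  diagonalised operator sees only the diagonal of \<open>M\<close> in that eigenbasis.\<close>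

lemma mtrace_diag_conj_mult:
  assumes U: "U \<in> carrier_mat n n" and M: "M \<in> carrier_mat n n"
  shows "mtrace (diag_conj n U f * M) = (\<Sum>i<n. f i * (mat_adjoint U * M * U) $$ (i, i))"
proof -
  have "mtrace (diag_conj n U f * M) = mtrace (U * (mat_diag n f * mat_adjoint U * M))"
    unfolding diag_conj_def using U M by (simp add: mult_square[of _ n])
  also have "\<dots> = mtrace (mat_diag n f * mat_adjoint U * M * U)"
    by (rule mtrace_comm[of _ n n]) (use U M in \<open>auto intro!: mult_square\<close>)
  also have "\<dots> = mtrace (mat_diag n f * (mat_adjoint U * M * U))"
    using U M by (simp add: mult_square[of _ n])
  also have "\<dots> = (\<Sum>i<n. f i * (mat_adjoint U * M * U) $$ (i, i))"
    by (subst mat_diag_mult_left[of _ n n])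
      (use U M in \<open>auto simp: mtrace_def intro!: mult_square sum.cong\<close>)
  finally show ?thesis .
qed

lemma mtrace_diag_conj:
  assumes "unitary_mat n U"
  shows "mtrace (diag_conj n U f) = (\<Sum>i<n. f i)"
proof -
  note U = unitary_matD[OF assms]
  show ?thesis using mtrace_diag_conj_mult[OF U(1) one_carrier_mat, of f] U
    by (simp add: right_mult_one_mat[of _ n n])
qed

lemma mat_powr_diag_conj:
  assumes U: "unitary_mat n U" and e: "\<And>i. i < n \<Longrightarrow> 0 \<le> e i"
  shows "mat_powr (diag_conj n U (\<lambda>i. complex_of_real (e i))) p
    = diag_conj n U (\<lambda>i. complex_of_real (e i powr p))"
proof -
  have dim: "dim_row (diag_conj n U (\<lambda>i. complex_of_real (e i))) = n"
    using unitary_matD[OF U] by simp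
  show ?thesis
    unfolding mat_powr_def Let_def dim
  proof (rule the_equality, goal_cases)
    case 1
    show ?case using U e by (intro exI[of _ U] exI[of _ e]) (auto simp: unitary_mat_def diag_conj_def)
  next
    case (2 Q)
    then obtain V f where V: "unitary_mat n V"
      and eq: "diag_conj n U (\<lambda>i. complex_of_real (e i)) = diag_conj n V (\<lambda>i. complex_of_real (f i))"
      and Q: "Q = diag_conj n V (\<lambda>i. complex_of_real (f i powr p))"
      by (auto simp: unitary_mat_def diag_conj_def)
    show ?case unfolding Q
      using diag_conj_unique[OF U V inj_of_real eq, of "\<lambda>x. complex_of_real (x powr p)"] by simp
  qed
qed

text \<open>For Hermitian operators the absolute value and its powers act on eigenvalues, so the
  norm is a normalised l^p norm of the list \<open>a\<close>. The operators measured below, d_j A, A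
  - C and the truncation B, are all Hermitian.\<close>

lemma schatten_diag_conj:
  assumes U: "unitary_mat (2 ^ n) U" and A: "A = diag_conj (2 ^ n) U (\<lambda>i. complex_of_real (a i))"
  shows "schatten n p A = ((\<Sum>i<2 ^ n. \<bar>a i\<bar> powr p) / 2 ^ n) powr (1 / p)"
proof -
  have "mat_adjoint A * A = diag_conj (2 ^ n) U (\<lambda>i. complex_of_real ((a i)\<^sup>2))"
    using unitary_matD[OF U] by (simp add: A diag_conj_adjoint diag_conj_mult[OF U] power2_eq_square)
  hence "mat_abs A = diag_conj (2 ^ n) U (\<lambda>i. complex_of_real ((a i)\<^sup>2 powr (1 / 2)))"
    unfolding mat_abs_def by (simp only:) (rule mat_powr_diag_conj[OF U], simp)
  also have "(\<lambda>i. complex_of_real ((a i)\<^sup>2 powr (1 / 2))) = (\<lambda>i. complex_of_real \<bar>a i\<bar>)"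
    by (simp add: powr_half_sqrt)
  finally have "mat_powr (mat_abs A) p = diag_conj (2 ^ n) U (\<lambda>i. complex_of_real (\<bar>a i\<bar> powr p))"
    using mat_powr_diag_conj[OF U, of "\<lambda>i. \<bar>a i\<bar>"] by simp
  thus ?thesis by (simp add: schatten_def mtrace_diag_conj[OF U])
qed

lemma schatten_one_diag_conj:
  assumes U: "unitary_mat (2 ^ n) U" and A: "A = diag_conj (2 ^ n) U (\<lambda>i. complex_of_real (a i))"
  shows "schatten n 1 A = (\<Sum>i<2 ^ n. \<bar>a i\<bar>) / 2 ^ n"
  using schatten_diag_conj[OF assms, of 1] by (simp add: sum_nonneg)

lemma schatten_two_power2:
  assumes A: "A \<in> carrier_mat (2 ^ n) (2 ^ n)" "mat_adjoint A = A"
  shows "(schatten n 2 A)\<^sup>2 = Re (mtrace (A * A)) / 2 ^ n" "schatten n 2 A \<ge> 0"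
proof -
  obtain U a where U: "unitary_mat (2 ^ n) U" and Ad: "A = diag_conj (2 ^ n) U (\<lambda>i. complex_of_real (a i))"
    using hermitian_diagonalization[OF A] by auto
  have s: "schatten n 2 A = sqrt ((\<Sum>i<2 ^ n. (a i)\<^sup>2) / 2 ^ n)"
    using schatten_diag_conj[OF U Ad, of 2]
    by (subst powr_half_sqrt[symmetric]) (auto intro!: divide_nonneg_nonneg sum_nonneg)
  show "schatten n 2 A \<ge> 0" unfolding s by (simp add: sum_nonneg)
  have "mtrace (A * A) = complex_of_real (\<Sum>i<2 ^ n. (a i)\<^sup>2)"
    by (simp add: Ad diag_conj_mult[OF U] mtrace_diag_conj[OF U] power2_eq_square)
  thus "(schatten n 2 A)\<^sup>2 = Re (mtrace (A * A)) / 2 ^ n"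
    unfolding s by (simp add: sum_nonneg)
qed

section \<open>The unnormalised Hilbert-Schmidt norm and Hoelder inequalities for the trace\<close>

definition frob :: "complex mat \<Rightarrow> real" where
  "frob M = sqrt (\<Sum>i<dim_row M. \<Sum>j<dim_col M. (cmod (M $$ (i, j)))\<^sup>2)"

lemma frob_nonneg: "frob M \<ge> 0"
  by (simp add: frob_def sum_nonneg)

lemma frob_power2: "M \<in> carrier_mat n m \<Longrightarrow> (frob M)\<^sup>2 = (\<Sum>i<n. \<Sum>j<m. (cmod (M $$ (i, j)))\<^sup>2)"
  by (simp add: frob_def sum_nonneg)

lemma mtrace_adjoint_mult:
  assumes M: "M \<in> carrier_mat n m"
  shows "mtrace (M * mat_adjoint M) = complex_of_real ((frob M)\<^sup>2)"
  unfolding mtrace_mult[OF M mat_adjoint_carrier[OF M]] frob_power2[OF M] of_real_sum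
  using M by (intro sum.cong) (auto simp: complex_norm_square simp del: of_real_power)

lemma cmod_mtrace_mult_le:
  assumes A: "A \<in> carrier_mat n m" and B: "B \<in> carrier_mat m n"
  shows "cmod (mtrace (A * B)) \<le> frob A * frob B"
proof -
  let ?I = "{..<n} \<times> {..<m}"
  have "cmod (mtrace (A * B)) \<le> (\<Sum>(i, j)\<in>?I. cmod (A $$ (i, j)) * cmod (B $$ (j, i)))"
    unfolding mtrace_mult[OF assms] sum.cartesian_product
    by (rule order_trans[OF norm_sum]) (auto simp: norm_mult intro!: sum_mono)
  also have "\<dots> \<le> sqrt (\<Sum>x\<in>?I. (cmod (A $$ x))\<^sup>2) * sqrt (\<Sum>x\<in>?I. (cmod (B $$ (snd x, fst x)))\<^sup>2)"
    using L2_set_mult_ineq[of "\<lambda>x. cmod (A $$ x)" "\<lambda>x. cmod (B $$ (snd x, fst x))" ?I]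
    by (simp add: case_prod_unfold L2_set_def)
  also have "sqrt (\<Sum>x\<in>?I. (cmod (A $$ x))\<^sup>2) = frob A"
    using A by (simp add: frob_def sum.cartesian_product case_prod_unfold)
  also have "(\<Sum>x\<in>?I. (cmod (B $$ (snd x, fst x)))\<^sup>2) = (\<Sum>i<n. \<Sum>j<m. (cmod (B $$ (j, i)))\<^sup>2)"
    by (simp add: sum.cartesian_product case_prod_unfold)
  also have "sqrt \<dots> = frob B"
    using B by (subst sum.swap) (simp add: frob_def)
  finally show ?thesis .
qed

text \<open>By cyclicity the left side is the trace of \<open>(B * B) * (A * A)\<close>, where
  Cauchy-Schwarz separates the two squares.\<close>

lemma frob_mult_le:
  assumes A: "A \<in> carrier_mat n n" "mat_adjoint A = A" and B: "B \<in> carrier_mat n n" "mat_adjoint B = B"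
  shows "(frob (A * B))\<^sup>2 \<le> frob (A * A) * frob (B * B)"
proof -
  have AB: "A * B \<in> carrier_mat n n" using A B by (simp add: mult_square)
  have "complex_of_real ((frob (A * B))\<^sup>2) = mtrace (A * B * (B * A))"
    using mtrace_adjoint_mult[OF AB] by (simp add: mat_adjoint_mult[OF A(1) B(1)] A B)
  also have "\<dots> = mtrace (A * (B * B * A))"
    using A B by (simp add: mult_square[of _ n])
  also have "\<dots> = mtrace (B * B * A * A)"
    by (rule mtrace_comm[of _ n n]) (use A B in \<open>auto intro!: mult_square\<close>)
  also have "\<dots> = mtrace ((B * B) * (A * A))"
    using A B by (simp add: mult_square[of _ n])
  finally have "(frob (A * B))\<^sup>2 = cmod (mtrace ((B * B) * (A * A)))"
    by (metis norm_of_real abs_power2)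
  also have "\<dots> \<le> frob (B * B) * frob (A * A)"
    by (rule cmod_mtrace_mult_le[of _ n n]) (use A B in \<open>auto intro!: mult_square\<close>)
  finally show ?thesis by (simp add: mult.commute)
qed

text \<open>Up to normalisation, \<open>sqrt (frob (A * A))\<close> is the Schatten 4-norm of a Hermitian \<open>A\<close>.\<close>

lemma cmod_mtrace_four_le:
  assumes A: "A \<in> carrier_mat n n" "mat_adjoint A = A" and B: "B \<in> carrier_mat n n" "mat_adjoint B = B"
    and C: "C \<in> carrier_mat n n" "mat_adjoint C = C" and D: "D \<in> carrier_mat n n" "mat_adjoint D = D"
  shows "cmod (mtrace (A * B * (C * D))) \<le>
    sqrt (frob (A * A)) * sqrt (frob (B * B)) * sqrt (frob (C * C)) * sqrt (frob (D * D))"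
proof -
  have "cmod (mtrace (A * B * (C * D))) \<le> frob (A * B) * frob (C * D)"
    by (rule cmod_mtrace_mult_le[of _ n n]) (use assms in \<open>auto intro!: mult_square\<close>)
  also have "\<dots> \<le> (sqrt (frob (A * A)) * sqrt (frob (B * B))) * (sqrt (frob (C * C)) * sqrt (frob (D * D)))"
  proof (rule mult_mono)
    show "frob (A * B) \<le> sqrt (frob (A * A)) * sqrt (frob (B * B))"
      using real_le_rsqrt[OF frob_mult_le[OF A B]] by (simp add: real_sqrt_mult)
    show "frob (C * D) \<le> sqrt (frob (C * C)) * sqrt (frob (D * D))"
      using real_le_rsqrt[OF frob_mult_le[OF C D]] by (simp add: real_sqrt_mult)
  qed (simp_all add: frob_nonneg)
  finally show ?thesis by (simp add: mult.assoc)
qed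

section \<open>Kronecker products and Pauli expansions\<close>

lemma sum_div_mod:
  fixes f :: "nat \<Rightarrow> nat \<Rightarrow> 'a :: comm_monoid_add"
  shows "(\<Sum>r<a * b. f (r div b) (r mod b)) = (\<Sum>i<a. \<Sum>k<b. f i k)"
proof -
  have "(\<Sum>r\<in>{i * b..<i * b + b}. f (r div b) (r mod b)) = (\<Sum>k<b. f i k)" for i
  proof -
    have "(\<Sum>r\<in>{i * b..<i * b + b}. f (r div b) (r mod b))
        = (\<Sum>k<b. f ((k + i * b) div b) ((k + i * b) mod b))"
      using sum.shift_bounds_nat_ivl[of "\<lambda>r. f (r div b) (r mod b)" 0 "i * b" b]
      by (simp add: atLeast0LessThan add.commute)
    thus ?thesis by simp
  qed
  thus ?thesis by (simp add: sum.nat_group[symmetric])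
qed

lemma div_mod_less:
  fixes r :: nat
  assumes "r < a * b"
  shows "r div b < a" "r mod b < b"
proof -
  have "b > 0" using assms by (cases b) auto
  thus "r div b < a" "r mod b < b" using assms by (auto simp: less_mult_imp_div_less)
qed

lemma pair_index_less:
  fixes i :: nat
  assumes "i < a" "k < b"
  shows "i * b + k < a * b"
proof -
  have "i * b + k < Suc i * b" using assms by simp
  also have "\<dots> \<le> a * b" using assms by (intro mult_right_mono) auto
  finally show ?thesis .
qed

lemma kron_dim [simp]:
  "dim_row (kron A B) = dim_row A * dim_row B" "dim_col (kron A B) = dim_col A * dim_col B"
  by (auto simp: kron_def)

lemma kron_carrier [simp]:
  "A \<in> carrier_mat a a' \<Longrightarrow> B \<in> carrier_mat b b' \<Longrightarrow> kron A B \<in> carrier_mat (a * b) (a' * b')"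
  by (metis carrier_matD carrier_matI kron_dim)

lemma kron_index:
  assumes "A \<in> carrier_mat a a'" "B \<in> carrier_mat b b'" "r < a * b" "c < a' * b'"
  shows "kron A B $$ (r, c) = A $$ (r div b, c div b') * B $$ (r mod b, c mod b')"
  using assms by (auto simp: kron_def)

lemma kron_mult:
  assumes A: "A \<in> carrier_mat a a" and B: "B \<in> carrier_mat b b"
    and C: "C \<in> carrier_mat a a" and D: "D \<in> carrier_mat b b"
  shows "kron A B * kron C D = kron (A * C) (B * D)"
proof (rule eq_matI)
  have AC: "A * C \<in> carrier_mat a a" and BD: "B * D \<in> carrier_mat b b" using assms by auto
  fix r c assume "r < dim_row (kron (A * C) (B * D))" "c < dim_col (kron (A * C) (B * D))"
  hence rc: "r < a * b" "c < a * b" using assms by auto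
  note rc' = div_mod_less[OF rc(1)] div_mod_less[OF rc(2)]
  have "(kron A B * kron C D) $$ (r, c) = (\<Sum>l<a * b. kron A B $$ (r, l) * kron C D $$ (l, c))"
    by (rule mult_index) (use assms rc in auto)
  also have "\<dots> = (\<Sum>l<a * b. (\<lambda>i k. A $$ (r div b, i) * C $$ (i, c div b) *
      (B $$ (r mod b, k) * D $$ (k, c mod b))) (l div b) (l mod b))"
    by (intro sum.cong) (use rc in \<open>auto simp: kron_index[OF A B] kron_index[OF C D]\<close>)
  also have "\<dots> = (\<Sum>i<a. A $$ (r div b, i) * C $$ (i, c div b)) * (\<Sum>k<b. B $$ (r mod b, k) * D $$ (k, c mod b))"
    unfolding sum_product by (rule sum_div_mod)
  also have "\<dots> = kron (A * C) (B * D) $$ (r, c)"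
    unfolding kron_index[OF AC BD rc] by (simp only: mult_index[OF A C] mult_index[OF B D] rc')
  finally show "(kron A B * kron C D) $$ (r, c) = kron (A * C) (B * D) $$ (r, c)" .
qed (use assms in auto)

lemma kron_assoc:
  assumes A: "A \<in> carrier_mat a a" and B: "B \<in> carrier_mat b b" and C: "C \<in> carrier_mat c c"
  shows "kron (kron A B) C = kron A (kron B C)"
proof (rule eq_matI)
  have AB: "kron A B \<in> carrier_mat (a * b) (a * b)" and BC: "kron B C \<in> carrier_mat (b * c) (b * c)"
    using assms by auto
  fix r s assume "r < dim_row (kron A (kron B C))" "s < dim_col (kron A (kron B C))"
  hence rs: "r < a * (b * c)" "s < a * (b * c)" using assms by auto
  hence rs': "r < (a * b) * c" "s < (a * b) * c" by (simp_all add: mult.assoc)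
  note 1 = div_mod_less[OF rs'(1)] div_mod_less[OF rs'(2)] div_mod_less[OF rs(1)] div_mod_less[OF rs(2)]
  have "x div (b * c) = x div c div b" "x mod (b * c) div c = x div c mod b"
    "x mod (b * c) mod c = x mod c" if "x < (a * b) * c" for x :: nat
  proof -
    have "c > 0" using that by (cases c) auto
    thus "x mod (b * c) div c = x div c mod b"
      by (simp add: mult.commute[of b] mod_mult2_eq)
    show "x div (b * c) = x div c div b" by (simp add: div_mult2_eq mult.commute[of b])
    show "x mod (b * c) mod c = x mod c" by (simp add: mod_mult2_eq mult.commute[of b])
  qed
  from this[OF rs'(1)] this[OF rs'(2)]
  show "kron (kron A B) C $$ (r, s) = kron A (kron B C) $$ (r, s)"
    unfolding kron_index[OF AB C rs'] kron_index[OF A BC rs] kron_index[OF A B 1(1,3)] kron_index[OF B C 1(6,8)]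
    by simp
qed (use assms in auto)

lemma kron_one_one: "kron (1\<^sub>m a) (1\<^sub>m b) = 1\<^sub>m (a * b)"
proof (rule eq_matI)
  fix r s assume "r < dim_row (1\<^sub>m (a * b))" "s < dim_col (1\<^sub>m (a * b))"
  hence rs: "r < a * b" "s < a * b" by auto
  note 1 = div_mod_less[OF rs(1)] div_mod_less[OF rs(2)]
  have "r = s \<longleftrightarrow> r div b = s div b \<and> r mod b = s mod b" by (metis div_mult_mod_eq)
  thus "kron (1\<^sub>m a) (1\<^sub>m b) $$ (r, s) = 1\<^sub>m (a * b) $$ (r, s)"
    unfolding kron_index[OF one_carrier_mat one_carrier_mat rs] using rs 1 by auto
qed auto

lemma kron_smult_right:
  assumes "A \<in> carrier_mat a a" "B \<in> carrier_mat b b"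
  shows "kron A (c \<cdot>\<^sub>m B) = c \<cdot>\<^sub>m kron A B"
  by (rule eq_matI)
    (use assms in \<open>auto simp: kron_def div_mod_less\<close>)

lemma kron_smult_left:
  assumes "A \<in> carrier_mat a a" "B \<in> carrier_mat b b"
  shows "kron (c \<cdot>\<^sub>m A) B = c \<cdot>\<^sub>m kron A B"
  by (rule eq_matI)
    (use assms in \<open>auto simp: kron_def div_mod_less\<close>)

lemma mat_adjoint_kron:
  assumes "A \<in> carrier_mat a a" "B \<in> carrier_mat b b"
  shows "mat_adjoint (kron A B) = kron (mat_adjoint A) (mat_adjoint B)"
  by (rule eq_matI)
    (use assms in \<open>auto simp: kron_def div_mod_less\<close>)

lemma mtrace_kron:
  assumes "A \<in> carrier_mat a a" "B \<in> carrier_mat b b"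
  shows "mtrace (kron A B) = mtrace A * mtrace B"
proof -
  have "mtrace (kron A B) = (\<Sum>r<a * b. (\<lambda>i k. A $$ (i, i) * B $$ (k, k)) (r div b) (r mod b))"
    using assms by (auto simp: mtrace_def kron_index[OF assms] intro!: sum.cong)
  also have "\<dots> = mtrace A * mtrace B"
    using assms by (subst sum_div_mod) (simp add: mtrace_def sum_product)
  finally show ?thesis .
qed

section \<open>Finite sums of matrices\<close>

lemma msum_carrier [simp]: "msum d f S \<in> carrier_mat d d"
  "dim_row (msum d f S) = d" "dim_col (msum d f S) = d"
  by (auto simp: msum_def)

lemma msum_index: "i < d \<Longrightarrow> j < d \<Longrightarrow> msum d f S $$ (i, j) = (\<Sum>s\<in>S. f s $$ (i, j))"
  by (simp add: msum_def)

lemma msum_cong: "(\<And>s. s \<in> S \<Longrightarrow> f s = g s) \<Longrightarrow> msum d f S = msum d g S"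
  unfolding msum_def by (auto intro!: eq_matI sum.cong)

lemma mtrace_msum:
  assumes "\<And>s. s \<in> S \<Longrightarrow> f s \<in> carrier_mat d d"
  shows "mtrace (msum d f S) = (\<Sum>s\<in>S. mtrace (f s))"
proof -
  have "mtrace (msum d f S) = (\<Sum>i<d. \<Sum>s\<in>S. f s $$ (i, i))"
    by (simp add: mtrace_def msum_index)
  also have "\<dots> = (\<Sum>s\<in>S. \<Sum>i<d. f s $$ (i, i))" by (rule sum.swap)
  also have "\<dots> = (\<Sum>s\<in>S. mtrace (f s))"
  proof (rule sum.cong)
    fix s assume "s \<in> S"
    hence "dim_row (f s) = d" using assms by blast
    thus "(\<Sum>i<d. f s $$ (i, i)) = mtrace (f s)" by (simp add: mtrace_def)
  qed simp
  finally show ?thesis .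
qed

lemma msum_mult_msum:
  assumes f: "\<And>s. s \<in> S \<Longrightarrow> f s \<in> carrier_mat d d" and g: "\<And>s. s \<in> T \<Longrightarrow> g s \<in> carrier_mat d d"
  shows "msum d f S * msum d g T = msum d (\<lambda>(s, t). f s * g t) (S \<times> T)"
proof (rule eq_matI)
  fix i j assume "i < dim_row (msum d (\<lambda>(s, t). f s * g t) (S \<times> T))" "j < dim_col (msum d (\<lambda>(s, t). f s * g t) (S \<times> T))"
  hence ij: "i < d" "j < d" by auto
  have "(msum d f S * msum d g T) $$ (i, j) = (\<Sum>l<d. \<Sum>(s, t)\<in>S \<times> T. f s $$ (i, l) * g t $$ (l, j))"
    unfolding mult_index[OF msum_carrier(1) msum_carrier(1) ij] using ij
    by (intro sum.cong refl) (simp add: msum_index sum_product sum.cartesian_product)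
  also have "\<dots> = (\<Sum>x\<in>S \<times> T. \<Sum>l<d. f (fst x) $$ (i, l) * g (snd x) $$ (l, j))"
    unfolding case_prod_unfold by (rule sum.swap)
  also have "\<dots> = (\<Sum>x\<in>S \<times> T. (f (fst x) * g (snd x)) $$ (i, j))"
  proof (rule sum.cong)
    fix x assume "x \<in> S \<times> T"
    hence "f (fst x) \<in> carrier_mat d d" "g (snd x) \<in> carrier_mat d d" using f g by auto
    from mult_index[OF this ij]
    show "(\<Sum>l<d. f (fst x) $$ (i, l) * g (snd x) $$ (l, j)) = (f (fst x) * g (snd x)) $$ (i, j)" ..
  qed simp
  finally show "(msum d f S * msum d g T) $$ (i, j) = msum d (\<lambda>(s, t). f s * g t) (S \<times> T) $$ (i, j)"
    using ij by (simp add: msum_index case_prod_unfold)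
qed auto

section \<open>Pauli matrices and Pauli strings\<close>

lemma pauli_carrier [simp]: "pauli k \<in> carrier_mat 2 2"
  "dim_row (pauli k) = 2" "dim_col (pauli k) = 2"
  by (auto simp: pauli_def mat_of_rows_list_def)

lemma pauli_index:
  "i < 2 \<Longrightarrow> j < 2 \<Longrightarrow> pauli k $$ (i, j) =
    (if k = 0 then (if i = j then 1 else 0)
     else if k = 1 then (if i = j then 0 else 1)
     else if k = 2 then (if i = j then 0 else if i = 0 then - \<i> else \<i>)
     else (if i = j then (if i = 0 then 1 else - 1) else 0))"
  by (auto simp: pauli_def mat_of_rows_list_def less_2_cases_iff)

lemma pauli_zero: "pauli 0 = 1\<^sub>m 2"
  by (rule eq_matI) (auto simp: pauli_index)

lemma mat_adjoint_pauli: "mat_adjoint (pauli k) = pauli k"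
  by (rule eq_matI) (auto simp: pauli_index)

lemma sum_lessThan_2: "(\<Sum>i<2. f i) = f 0 + f (1 :: nat)"
  by (simp add: numeral_2_eq_2)

lemma pauli_mult_index:
  "i < 2 \<Longrightarrow> j < 2 \<Longrightarrow> (pauli a * pauli b) $$ (i, j) =
    pauli a $$ (i, 0) * pauli b $$ (0, j) + pauli a $$ (i, 1) * pauli b $$ (1, j)"
  by (simp only: mult_index[OF pauli_carrier(1) pauli_carrier(1)] sum_lessThan_2)

lemma pauli_square: "pauli a * pauli a = 1\<^sub>m 2"
  by (rule eq_matI) (auto simp: pauli_mult_index pauli_index less_2_cases_iff simp del: index_mult_mat(1))

text \<open>The bounds on the indices matter: \<open>pauli\<close> sends every index from 3 on to
  the same matrix, so distinct large indices would commute.\<close>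

lemma pauli_commute:
  assumes "a \<le> 3" "b \<le> 3"
  shows "pauli a * pauli b = (if a = 0 \<or> b = 0 \<or> a = b then 1 else - 1) \<cdot>\<^sub>m (pauli b * pauli a)"
  by (rule eq_matI) (use assms in \<open>auto simp: pauli_mult_index pauli_index less_2_cases_iff simp del: index_mult_mat(1)\<close>)

lemma mtrace_pauli: "a \<noteq> 0 \<Longrightarrow> mtrace (pauli a) = 0"
  by (simp add: mtrace_def sum_lessThan_2 pauli_index)

lemma mtrace_pauli_mult: "a \<le> 3 \<Longrightarrow> b \<le> 3 \<Longrightarrow> mtrace (pauli a * pauli b) = (if a = b then 2 else 0)"
  by (auto simp: mtrace_def sum_lessThan_2 pauli_mult_index pauli_index simp del: index_mult_mat(1))

text \<open>In coordinates: the sum of \<open>kron (pauli a) (pauli a)\<close> is twice the swap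
  operator. It is the source of the spanning property of Pauli strings.\<close>

lemma pauli_completeness:
  assumes "i < 2" "j < 2" "k < 2" "l < 2"
  shows "(\<Sum>a<4. pauli a $$ (j, i) * pauli a $$ (k, l)) = (if j = l \<and> i = k then 2 else 0)"
  using assms by (auto simp: less_2_cases_iff pauli_index eval_nat_numeral)

lemma pauli_indices_0: "pauli_indices 0 = {[]}"
  by (auto simp: pauli_indices_def)

lemma pauli_indices_Suc: "pauli_indices (Suc n) = (\<lambda>(a, s). a # s) ` ({..<4} \<times> pauli_indices n)"
proof -
  have "{0, 1, 2, 3} = {..<4 :: nat}" by auto
  thus ?thesis unfolding pauli_indices_def by (auto simp: length_Suc_conv image_iff)
qed

lemma finite_pauli_indices [simp]: "finite (pauli_indices n)"
  by (induction n) (simp_all add: pauli_indices_0 pauli_indices_Suc)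

lemma pauli_indicesD: "s \<in> pauli_indices n \<Longrightarrow> length s = n"
  "s \<in> pauli_indices n \<Longrightarrow> i < n \<Longrightarrow> s ! i \<le> 3"
proof -
  show "s \<in> pauli_indices n \<Longrightarrow> length s = n" by (simp add: pauli_indices_def)
  assume "s \<in> pauli_indices n" "i < n"
  hence "s ! i \<in> {0, 1, 2, 3}" unfolding pauli_indices_def using nth_mem by blast
  thus "s ! i \<le> 3" by auto
qed

lemma sum_pauli_indices_Suc:
  "(\<Sum>t\<in>pauli_indices (Suc n). f t) = (\<Sum>a<4. \<Sum>s\<in>pauli_indices n. f (a # s))"
  unfolding pauli_indices_Suc sum.cartesian_product
  by (subst sum.reindex) (auto simp: inj_on_def case_prod_unfold)

lemma pauli_tensor_simps:
  "pauli_tensor [] = 1\<^sub>m 1" "pauli_tensor (a # s) = kron (pauli a) (pauli_tensor s)"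
  by (simp_all add: pauli_tensor_def)

lemma pauli_tensor_dim [simp]:
  "dim_row (pauli_tensor s) = 2 ^ length s" "dim_col (pauli_tensor s) = 2 ^ length s"
  by (induction s) (auto simp: pauli_tensor_simps)

lemma pauli_tensor_carrier_length: "pauli_tensor s \<in> carrier_mat (2 ^ length s) (2 ^ length s)"
  by (intro carrier_matI) auto

lemma pauli_tensor_carrier [simp]: "s \<in> pauli_indices n \<Longrightarrow> pauli_tensor s \<in> carrier_mat (2 ^ n) (2 ^ n)"
  using pauli_tensor_carrier_length[of s] pauli_indicesD(1)[of s n] by simp

lemma mat_adjoint_pauli_tensor: "mat_adjoint (pauli_tensor s) = pauli_tensor s"
  by (induction s)
    (auto simp: pauli_tensor_simps mat_adjoint_kron[OF pauli_carrier(1) pauli_tensor_carrier_length] mat_adjoint_pauli)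

lemma kron_one_left: "A \<in> carrier_mat a a \<Longrightarrow> kron (1\<^sub>m 1) A = A"
  by (rule eq_matI) (auto simp: kron_def)

lemma pauli_tensor_append:
  "pauli_tensor (s @ t) = kron (pauli_tensor s) (pauli_tensor t)"
  by (induction s)
    (simp_all add: pauli_tensor_simps kron_one_left[OF pauli_tensor_carrier_length, simplified]
      kron_assoc[OF pauli_carrier(1) pauli_tensor_carrier_length pauli_tensor_carrier_length])

lemma mtrace_pauli_tensor_mult:
  assumes "s \<in> pauli_indices n" "t \<in> pauli_indices n"
  shows "mtrace (pauli_tensor s * pauli_tensor t) = (if s = t then 2 ^ n else 0)"
  using assms
proof (induction n arbitrary: s t)
  case 0
  thus ?case by (simp add: pauli_indices_0 pauli_tensor_simps mtrace_one)
next
  case (Suc n)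
  obtain a s' where s: "s = a # s'" "a < 4" "s' \<in> pauli_indices n" using Suc.prems(1) by (auto simp: pauli_indices_Suc)
  obtain b t' where t: "t = b # t'" "b < 4" "t' \<in> pauli_indices n" using Suc.prems(2) by (auto simp: pauli_indices_Suc)
  have "mtrace (pauli_tensor s * pauli_tensor t) = mtrace (pauli a * pauli b) * mtrace (pauli_tensor s' * pauli_tensor t')"
    using s t by (simp add: pauli_tensor_simps kron_mult[of _ 2 _ "2 ^ n"] mtrace_kron[of _ 2 _ "2 ^ n"] mult_square(1)[of _ "2 ^ n"] mult_square(1)[of _ 2])
  thus ?case using s t Suc.IH[OF s(3) t(3)] by (simp add: mtrace_pauli_mult)
qed

lemma pauli_tensor_completeness:
  assumes "i < 2 ^ n" "j < 2 ^ n" "k < 2 ^ n" "l < 2 ^ n"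
  shows "(\<Sum>s\<in>pauli_indices n. pauli_tensor s $$ (j, i) * pauli_tensor s $$ (k, l))
    = (if j = l \<and> i = k then 2 ^ n else 0)"
  using assms
proof (induction n arbitrary: i j k l)
  case 0
  thus ?case by (simp add: pauli_indices_0 pauli_tensor_simps)
next
  case (Suc n)
  have less: "i < 2 * 2 ^ n" "j < 2 * 2 ^ n" "k < 2 * 2 ^ n" "l < 2 * 2 ^ n" using Suc.prems by auto
  let ?N = "2 ^ n :: nat"
  note d = div_mod_less[OF less(1)] div_mod_less[OF less(2)] div_mod_less[OF less(3)] div_mod_less[OF less(4)]
  have "(\<Sum>s\<in>pauli_indices (Suc n). pauli_tensor s $$ (j, i) * pauli_tensor s $$ (k, l))
     = (\<Sum>a<4. \<Sum>s\<in>pauli_indices n. (pauli a $$ (j div ?N, i div ?N) * pauli a $$ (k div ?N, l div ?N)) *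
        (pauli_tensor s $$ (j mod ?N, i mod ?N) * pauli_tensor s $$ (k mod ?N, l mod ?N)))"
    unfolding sum_pauli_indices_Suc pauli_tensor_simps using less
    by (intro sum.cong) (auto simp: kron_index[OF pauli_carrier(1) pauli_tensor_carrier])
  also have "\<dots> = (\<Sum>a<4. pauli a $$ (j div ?N, i div ?N) * pauli a $$ (k div ?N, l div ?N)) *
      (\<Sum>s\<in>pauli_indices n. pauli_tensor s $$ (j mod ?N, i mod ?N) * pauli_tensor s $$ (k mod ?N, l mod ?N))"
    by (simp only: sum_product)
  also have "\<dots> = (if j div ?N = l div ?N \<and> i div ?N = k div ?N then 2 else 0) *
     (if j mod ?N = l mod ?N \<and> i mod ?N = k mod ?N then 2 ^ n else 0)"
    by (simp only: pauli_completeness Suc.IH d)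
  also have "\<dots> = (if j = l \<and> i = k then 2 ^ Suc n else 0)"
  proof -
    have "x = y \<longleftrightarrow> x div ?N = y div ?N \<and> x mod ?N = y mod ?N" for x y :: nat by (metis div_mult_mod_eq)
    from this[of j l] this[of i k] show ?thesis by auto
  qed
  finally show ?case .
qed

section \<open>Pauli expansions: coefficients, completeness, Parseval\<close>

definition pauli_sum :: "nat \<Rightarrow> (nat list \<Rightarrow> complex) \<Rightarrow> complex mat" where
  "pauli_sum n c = msum (2 ^ n) (\<lambda>s. c s \<cdot>\<^sub>m pauli_tensor s) (pauli_indices n)"

lemma pauli_sum_carrier [simp]: "pauli_sum n c \<in> carrier_mat (2 ^ n) (2 ^ n)"
  "dim_row (pauli_sum n c) = 2 ^ n" "dim_col (pauli_sum n c) = 2 ^ n"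
  by (auto simp: pauli_sum_def)

lemma pauli_sum_index:
  assumes "i < 2 ^ n" "j < 2 ^ n"
  shows "pauli_sum n c $$ (i, j) = (\<Sum>s\<in>pauli_indices n. c s * pauli_tensor s $$ (i, j))"
  unfolding pauli_sum_def msum_index[OF assms] using assms
  by (intro sum.cong) (auto simp: pauli_indicesD)

lemma pauli_sum_cong: "(\<And>s. s \<in> pauli_indices n \<Longrightarrow> c s = c' s) \<Longrightarrow> pauli_sum n c = pauli_sum n c'"
  unfolding pauli_sum_def by (rule msum_cong) simp

text \<open>The computable form of \<open>pauli_coeff\<close>, which is defined only by a unique
  description.\<close>

definition pauli_inner :: "nat \<Rightarrow> complex mat \<Rightarrow> nat list \<Rightarrow> complex" where
  "pauli_inner n A s = mtrace (pauli_tensor s * A) / 2 ^ n"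

lemma mtrace_mult_pauli_sum:
  assumes M: "M \<in> carrier_mat (2 ^ n) (2 ^ n)"
  shows "mtrace (M * pauli_sum n c) = (\<Sum>s\<in>pauli_indices n. c s * mtrace (M * pauli_tensor s))"
proof -
  let ?N = "2 ^ n :: nat"
  have "mtrace (M * pauli_sum n c) = (\<Sum>i<?N. \<Sum>j<?N. \<Sum>s\<in>pauli_indices n. c s * (M $$ (i, j) * pauli_tensor s $$ (j, i)))"
    unfolding mtrace_mult[OF M pauli_sum_carrier(1)]
    by (intro sum.cong) (auto simp: pauli_sum_index sum_distrib_left mult_ac)
  also have "\<dots> = (\<Sum>s\<in>pauli_indices n. c s * (\<Sum>i<?N. \<Sum>j<?N. M $$ (i, j) * pauli_tensor s $$ (j, i)))"
    unfolding sum_distrib_left by (subst sum.swap[of _ "{..<?N}" "pauli_indices n"], subst sum.swap[of _ "{..<?N}" "pauli_indices n"]) simp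
  also have "\<dots> = (\<Sum>s\<in>pauli_indices n. c s * mtrace (M * pauli_tensor s))"
    by (intro sum.cong) (auto simp: mtrace_mult[OF M pauli_tensor_carrier])
  finally show ?thesis .
qed

lemma pauli_inner_pauli_sum:
  assumes "s \<in> pauli_indices n"
  shows "pauli_inner n (pauli_sum n c) s = c s"
proof -
  have "mtrace (pauli_tensor s * pauli_sum n c) = (\<Sum>t\<in>pauli_indices n. c t * (if s = t then 2 ^ n else 0))"
    unfolding mtrace_mult_pauli_sum[OF pauli_tensor_carrier[OF assms]]
    by (intro sum.cong) (auto simp: mtrace_pauli_tensor_mult assms)
  also have "\<dots> = (\<Sum>t\<in>pauli_indices n. if s = t then c t * 2 ^ n else 0)"
    by (intro sum.cong) auto
  also have "\<dots> = c s * 2 ^ n" using assms by (subst sum.delta') auto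
  finally show ?thesis by (simp add: pauli_inner_def)
qed

text \<open>Spanning is obtained without a dimension count: after expanding the traces and
  exchanging sums, the completeness relation leaves a single entry of \<open>A\<close>.\<close>

lemma pauli_sum_pauli_inner:
  assumes A: "A \<in> carrier_mat (2 ^ n) (2 ^ n)"
  shows "pauli_sum n (pauli_inner n A) = A"
proof (rule eq_matI)
  let ?N = "2 ^ n :: nat"
  fix k l assume "k < dim_row A" "l < dim_col A"
  hence kl: "k < ?N" "l < ?N" using A by auto
  have "2 ^ n * pauli_sum n (pauli_inner n A) $$ (k, l)
     = (\<Sum>s\<in>pauli_indices n. \<Sum>j<?N. \<Sum>i<?N. A $$ (i, j) * (pauli_tensor s $$ (j, i) * pauli_tensor s $$ (k, l)))"
    unfolding pauli_sum_index[OF kl] sum_distrib_left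
    by (intro sum.cong refl)
      (simp add: pauli_inner_def mtrace_mult[OF pauli_tensor_carrier A] sum_distrib_left sum_distrib_right sum_divide_distrib mult_ac)
  also have "\<dots> = (\<Sum>j<?N. \<Sum>i<?N. A $$ (i, j) * (\<Sum>s\<in>pauli_indices n. pauli_tensor s $$ (j, i) * pauli_tensor s $$ (k, l)))"
    unfolding sum_distrib_left
    by (subst sum.swap[of _ "{..<?N}" "pauli_indices n"], subst sum.swap[of _ "{..<?N}" "pauli_indices n"]) simp
  also have "\<dots> = (\<Sum>j<?N. \<Sum>i<?N. if i = k then (if j = l then A $$ (i, j) * 2 ^ n else 0) else 0)"
    by (intro sum.cong refl) (auto simp: pauli_tensor_completeness kl)
  also have "\<dots> = A $$ (k, l) * 2 ^ n"
    using kl by (simp add: sum.delta)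
  finally show "pauli_sum n (pauli_inner n A) $$ (k, l) = A $$ (k, l)" by simp
qed (use A in auto)

text \<open>Completeness gives existence of the expansion and orthogonality its uniqueness; the
  value 0 off the index set pins the function down elsewhere.\<close>

lemma pauli_coeff_eq:
  assumes A: "A \<in> carrier_mat (2 ^ n) (2 ^ n)" and s: "s \<in> pauli_indices n"
  shows "pauli_coeff n A s = pauli_inner n A s"
proof -
  have "pauli_coeff n A = (\<lambda>s. if s \<in> pauli_indices n then pauli_inner n A s else 0)"
    unfolding pauli_coeff_def pauli_sum_def[symmetric]
  proof (rule the_equality, goal_cases)
    case 1
    have "A = pauli_sum n (\<lambda>s. if s \<in> pauli_indices n then pauli_inner n A s else 0)"
      by (subst pauli_sum_pauli_inner[OF A, symmetric]) (rule pauli_sum_cong, simp)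
    thus ?case by simp
  next
    case (2 c)
    thus ?case using pauli_inner_pauli_sum[of _ n c] by (intro ext) auto
  qed
  thus ?thesis using s by simp
qed

text \<open>Parseval in bilinear form, without a conjugate. For Hermitian operators the coefficients
  are real, so it is also the inner product.\<close>

lemma mtrace_pauli_sum_mult:
  "mtrace (pauli_sum n c * pauli_sum n c') = 2 ^ n * (\<Sum>s\<in>pauli_indices n. c s * c' s)"
proof -
  have "mtrace (pauli_sum n c * pauli_sum n c') = (\<Sum>s\<in>pauli_indices n. c' s * mtrace (pauli_sum n c * pauli_tensor s))"
    by (rule mtrace_mult_pauli_sum) simp
  also have "\<dots> = (\<Sum>s\<in>pauli_indices n. c' s * (2 ^ n * c s))"
  proof (intro sum.cong refl arg_cong2[of _ _ _ _ "(*)"])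
    fix s assume s: "s \<in> pauli_indices n"
    show "mtrace (pauli_sum n c * pauli_tensor s) = 2 ^ n * c s"
      using pauli_inner_pauli_sum[OF s, of c] mtrace_comm[OF pauli_sum_carrier(1) pauli_tensor_carrier[OF s], of c]
      by (simp add: pauli_inner_def field_simps)
  qed
  finally show ?thesis by (simp add: sum_distrib_left mult_ac)
qed

lemma pauli_inner_real:
  assumes A: "A \<in> carrier_mat (2 ^ n) (2 ^ n)" "mat_adjoint A = A" and s: "s \<in> pauli_indices n"
  shows "pauli_inner n A s = complex_of_real (Re (pauli_inner n A s))"
proof -
  note P = pauli_tensor_carrier[OF s]
  have adj: "mtrace (mat_adjoint M) = cnj (mtrace M)" if "M \<in> carrier_mat d d" for M d
    using that by (auto simp: mtrace_def)
  have "cnj (mtrace (pauli_tensor s * A)) = mtrace (mat_adjoint (pauli_tensor s * A))"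
    using A P by (intro adj[symmetric, of _ "2 ^ n"]) (auto intro: mult_square)
  also have "\<dots> = mtrace (A * pauli_tensor s)"
    using A P by (simp add: mat_adjoint_mult[OF P A(1)] mat_adjoint_pauli_tensor)
  also have "\<dots> = mtrace (pauli_tensor s * A)" by (rule mtrace_comm[OF A(1) P])
  finally have "cnj (pauli_inner n A s) = pauli_inner n A s" by (simp add: pauli_inner_def)
  thus ?thesis by (metis Reals_cnj_iff of_real_Re)
qed

lemma mat_adjoint_pauli_sum:
  "mat_adjoint (pauli_sum n (\<lambda>s. complex_of_real (c s))) = pauli_sum n (\<lambda>s. complex_of_real (c s))"
proof (rule eq_matI)
  fix i j assume "i < dim_row (pauli_sum n (\<lambda>s. complex_of_real (c s)))" "j < dim_col (pauli_sum n (\<lambda>s. complex_of_real (c s)))"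
  hence "i < 2 ^ n" "j < 2 ^ n" by auto
  thus "mat_adjoint (pauli_sum n (\<lambda>s. complex_of_real (c s))) $$ (i, j) = pauli_sum n (\<lambda>s. complex_of_real (c s)) $$ (i, j)"
    by (auto simp: pauli_sum_index intro!: sum.cong
      hermitian_index[OF pauli_tensor_carrier mat_adjoint_pauli_tensor, symmetric])
qed auto

section \<open>Hypercontractivity\<close>

definition pauli_weight :: "nat list \<Rightarrow> nat" where
  "pauli_weight s = length (filter (\<lambda>k. k \<noteq> 0) s)"

lemma pauli_weight_simps [simp]:
  "pauli_weight [] = 0" "pauli_weight (0 # s) = pauli_weight s"
  "a \<noteq> 0 \<Longrightarrow> pauli_weight (a # s) = Suc (pauli_weight s)"
  by (auto simp: pauli_weight_def)

lemma pauli_sum_Suc: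
  "pauli_sum (Suc n) c = msum (2 * 2 ^ n) (\<lambda>a. kron (pauli a) (pauli_sum n (\<lambda>s. c (a # s)))) {..<4}"
proof (rule eq_matI)
  let ?N = "2 ^ n :: nat"
  fix i j assume "i < dim_row (msum (2 * 2 ^ n) (\<lambda>a. kron (pauli a) (pauli_sum n (\<lambda>s. c (a # s)))) {..<4})"
    "j < dim_col (msum (2 * 2 ^ n) (\<lambda>a. kron (pauli a) (pauli_sum n (\<lambda>s. c (a # s)))) {..<4})"
  hence ij: "i < 2 * ?N" "j < 2 * ?N" by auto
  note d = div_mod_less[OF ij(1)] div_mod_less[OF ij(2)]
  have "pauli_sum (Suc n) c $$ (i, j) = (\<Sum>a<4. \<Sum>s\<in>pauli_indices n.
      c (a # s) * (pauli a $$ (i div ?N, j div ?N) * pauli_tensor s $$ (i mod ?N, j mod ?N)))"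
    using ij by (subst pauli_sum_index)
      (auto simp: sum_pauli_indices_Suc pauli_tensor_simps kron_index[OF pauli_carrier(1) pauli_tensor_carrier]
        intro!: sum.cong)
  also have "\<dots> = (\<Sum>a<4. kron (pauli a) (pauli_sum n (\<lambda>s. c (a # s))) $$ (i, j))"
    by (intro sum.cong refl)
      (simp add: kron_index[OF pauli_carrier(1) pauli_sum_carrier(1) ij] pauli_sum_index d sum_distrib_left mult_ac)
  finally show "pauli_sum (Suc n) c $$ (i, j) = msum (2 * 2 ^ n) (\<lambda>a. kron (pauli a) (pauli_sum n (\<lambda>s. c (a # s)))) {..<4} $$ (i, j)"
    using ij by (simp add: msum_index)
qed auto

text \<open>The four-factor Hoelder inequality replaces a computation of all 256 traces: every
  square is the identity, and the bound is the square of \<open>frob (1\<^sub>m 2)\<close>, which is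
  2.\<close>

lemma cmod_mtrace_pauli_four_le:
  "cmod (mtrace (pauli a * pauli b * (pauli c * pauli d))) \<le> 2"
proof -
  have f: "sqrt (frob (1\<^sub>m 2)) * sqrt (frob (1\<^sub>m 2)) = sqrt 2"
    by (simp add: frob_def sum_lessThan_2)
  have "cmod (mtrace (pauli a * pauli b * (pauli c * pauli d))) \<le>
      sqrt (frob (1\<^sub>m 2)) * sqrt (frob (1\<^sub>m 2)) * sqrt (frob (1\<^sub>m 2)) * sqrt (frob (1\<^sub>m 2))"
    using cmod_mtrace_four_le[of "pauli a" 2 "pauli b" "pauli c" "pauli d"]
    by (simp add: mat_adjoint_pauli pauli_square)
  also have "\<dots> = sqrt 2 * sqrt 2" by (metis f mult.assoc)
  finally show ?thesis by simp
qed

text \<open>Other index patterns have zero trace too, but this one alone produces a term linear in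
  the nontrivial part; the rest is estimated by absolute values.\<close>

definition three_zeros :: "nat \<Rightarrow> nat \<Rightarrow> nat \<Rightarrow> nat \<Rightarrow> bool" where
  "three_zeros a b c d \<longleftrightarrow>
     a = 0 \<and> b = 0 \<and> c = 0 \<and> d \<noteq> 0 \<or> a = 0 \<and> b = 0 \<and> c \<noteq> 0 \<and> d = 0 \<or>
     a = 0 \<and> b \<noteq> 0 \<and> c = 0 \<and> d = 0 \<or> a \<noteq> 0 \<and> b = 0 \<and> c = 0 \<and> d = 0"

lemma mtrace_pauli_four_eq_0:
  assumes "three_zeros a b c d"
  shows "mtrace (pauli a * pauli b * (pauli c * pauli d)) = 0"
  using assms unfolding three_zeros_def
  by (elim disjE conjE) (simp_all add: pauli_zero left_mult_one_mat[of _ 2 2] right_mult_one_mat[of _ 2 2] mtrace_pauli)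

lemma sum_lessThan_4: "(\<Sum>i<4. f i) = f 0 + f 1 + f 2 + f (3 :: nat)"
  by (simp add: eval_nat_numeral)

text \<open>For small \<open>x 1\<close>, \<open>x 2\<close>, \<open>x 3\<close> the right side
  exceeds \<open>x 0 ^ 4\<close> only to second order, so the linear term
  \<open>4 * x 0 ^ 3 * y\<close> of the full fourth power has to be absent. Removing the
  \<open>three_zeros\<close> terms removes exactly it.\<close>

lemma sum_four_le:
  fixes x :: "nat \<Rightarrow> real"
  assumes "\<And>a. x a \<ge> 0"
  shows "(\<Sum>a<4. \<Sum>b<4. \<Sum>c<4. \<Sum>d<4. if three_zeros a b c d then 0 else x a * x b * (x c * x d))
    \<le> ((x 0)\<^sup>2 + 16 * ((x 1)\<^sup>2 + (x 2)\<^sup>2 + (x 3)\<^sup>2))\<^sup>2"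
proof -
  define y where "y = x 1 + x 2 + x 3"
  define z where "z = (x 1)\<^sup>2 + (x 2)\<^sup>2 + (x 3)\<^sup>2"
  have all: "(\<Sum>a<4. \<Sum>b<4. \<Sum>c<4. \<Sum>d<4. x a * x b * (x c * x d)) = (x 0 + y) ^ 4"
  proof -
    have "(\<Sum>a<4. \<Sum>b<4. \<Sum>c<4. \<Sum>d<4. x a * x b * (x c * x d))
      = (\<Sum>a<4. x a) * (\<Sum>b<4. x b) * ((\<Sum>c<4. x c) * (\<Sum>d<4. x d))"
      by (simp only: sum_distrib_left[symmetric] sum_distrib_right[symmetric])
    also have "(\<Sum>a<4. x a) = x 0 + y" by (simp add: y_def sum_lessThan_4)
    finally show ?thesis by (simp add: power4_eq_xxxx mult.assoc)
  qed
  have sub: "(\<Sum>a<4. \<Sum>b<4. \<Sum>c<4. \<Sum>d<4. if three_zeros a b c d then x a * x b * (x c * x d) else 0)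
     = 4 * x 0 ^ 3 * y"
    by (simp add: sum_lessThan_4 three_zeros_def y_def power3_eq_cube algebra_simps)
  have "(\<Sum>a<4. \<Sum>b<4. \<Sum>c<4. \<Sum>d<4. if three_zeros a b c d then 0 else x a * x b * (x c * x d))
     = (\<Sum>a<4. \<Sum>b<4. \<Sum>c<4. \<Sum>d<4. x a * x b * (x c * x d) -
        (if three_zeros a b c d then x a * x b * (x c * x d) else 0))"
    by (intro sum.cong refl) auto
  also have "\<dots> = (x 0 + y) ^ 4 - 4 * x 0 ^ 3 * y"
    unfolding sum_subtractf all sub ..
  \<comment> \<open>The odd term \<open>4 * x 0 * y ^ 3\<close> is absorbed by completing a square,
    leaving even powers only.\<close>
  also have "\<dots> = (x 0) ^ 4 + 8 * (x 0)\<^sup>2 * y\<^sup>2 + 3 * y ^ 4 - 2 * (y * (x 0 - y))\<^sup>2"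
    by (simp add: power4_eq_xxxx power2_eq_square power3_eq_cube algebra_simps)
  also have "\<dots> \<le> (x 0) ^ 4 + 8 * (x 0)\<^sup>2 * y\<^sup>2 + 3 * y ^ 4" by simp
  also have "\<dots> \<le> ((x 0)\<^sup>2 + 4 * y\<^sup>2)\<^sup>2"
  proof -
    have "((x 0)\<^sup>2 + 4 * y\<^sup>2)\<^sup>2 = (x 0) ^ 4 + 8 * (x 0)\<^sup>2 * y\<^sup>2 + 16 * y ^ 4"
      by (simp add: power4_eq_xxxx power2_eq_square algebra_simps)
    thus ?thesis using zero_le_even_power[of 4 y] by simp
  qed
  also have "\<dots> \<le> ((x 0)\<^sup>2 + 16 * z)\<^sup>2"
  proof (rule power_mono)
    \<comment> \<open>Cauchy-Schwarz for three summands, written as a sum of squares. The constant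
      obtained is 4 * 3 = 12, rounded up to 16.\<close>
    have "3 * z - y\<^sup>2 = (x 1 - x 2)\<^sup>2 + (x 1 - x 3)\<^sup>2 + (x 2 - x 3)\<^sup>2"
      by (simp add: y_def z_def power2_eq_square algebra_simps)
    hence "y\<^sup>2 \<le> 3 * z" by (smt (verit) zero_le_power2)
    moreover have "z \<ge> 0" by (simp add: z_def)
    ultimately show "(x 0)\<^sup>2 + 4 * y\<^sup>2 \<le> (x 0)\<^sup>2 + 16 * z" by linarith
  qed simp
  finally show ?thesis by (simp add: z_def)
qed

text \<open>
  Terms with exactly one factor \<open>a \<noteq> 0\<close> vanish in the expansion of the trace of the fourth power,
  because \<open>mtrace (pauli a) = 0\<close>; this is what makes the induction over the qubits go through.
\<close>

lemma pauli_hypercontractivity: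
  fixes c :: "nat list \<Rightarrow> real" and n :: nat
  defines "F \<equiv> pauli_sum n (\<lambda>s. complex_of_real (c s))"
  shows "frob (F * F) \<le> sqrt (2 ^ n) * (\<Sum>s\<in>pauli_indices n. 16 ^ pauli_weight s * (c s)\<^sup>2)"
  unfolding F_def
proof (induction n arbitrary: c)
  case 0
  let ?F = "pauli_sum 0 (\<lambda>s. complex_of_real (c s))"
  have "?F $$ (0, 0) = c []" by (simp add: pauli_sum_index pauli_indices_0 pauli_tensor_simps)
  moreover have "(?F * ?F) $$ (0, 0) = ?F $$ (0, 0) * ?F $$ (0, 0)"
    using mult_index[of ?F 1 1 ?F 1 0 0] pauli_sum_carrier(1)[of 0] by simp
  ultimately show ?case
    by (simp add: frob_def pauli_indices_0 norm_mult power2_eq_square del: index_mult_mat(1))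
next
  case (Suc n)
  let ?N = "2 ^ n :: nat"
  define G where "G a = pauli_sum n (\<lambda>s. complex_of_real (c (a # s)))" for a
  define S where "S a = (\<Sum>s\<in>pauli_indices n. 16 ^ pauli_weight s * (c (a # s))\<^sup>2)" for a
  define x where "x a = sqrt (frob (G a * G a))" for a
  define F where "F = pauli_sum (Suc n) (\<lambda>s. complex_of_real (c s))"
  have G: "G a \<in> carrier_mat ?N ?N" "mat_adjoint (G a) = G a" for a
    by (simp_all add: G_def mat_adjoint_pauli_sum)
  have x0: "x a \<ge> 0" for a by (simp add: x_def frob_nonneg)
  have xS: "(x a)\<^sup>2 \<le> sqrt (2 ^ n) * S a" for a
    using Suc.IH[of "\<lambda>s. c (a # s)"] by (simp add: x_def frob_nonneg G_def S_def)
  have F: "F = msum (2 * ?N) (\<lambda>a. kron (pauli a) (G a)) {..<4}"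
    unfolding F_def pauli_sum_Suc G_def ..
  have Fc: "F \<in> carrier_mat (2 ^ Suc n) (2 ^ Suc n)" "mat_adjoint F = F"
    unfolding F_def by (rule pauli_sum_carrier, rule mat_adjoint_pauli_sum)
  have KG: "kron (pauli a) (G a) \<in> carrier_mat (2 * ?N) (2 * ?N)" for a using G by simp
  have FF: "F * F = msum (2 * ?N) (\<lambda>(a, b). kron (pauli a * pauli b) (G a * G b)) ({..<4} \<times> {..<4})"
    unfolding F by (subst msum_mult_msum) (use G KG in \<open>auto simp: kron_mult[of _ 2 _ ?N] intro!: msum_cong\<close>)
  have KGG: "kron (pauli a * pauli b) (G a * G b) \<in> carrier_mat (2 * ?N) (2 * ?N)" for a b
    using G by (intro kron_carrier mult_square) auto
  have FFFF: "F * F * (F * F) = msum (2 * ?N) (\<lambda>((a, b), (c, d)).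
      kron (pauli a * pauli b * (pauli c * pauli d)) (G a * G b * (G c * G d))) (({..<4} \<times> {..<4}) \<times> ({..<4} \<times> {..<4}))"
    unfolding FF
    by (subst msum_mult_msum)
      (use G KGG in \<open>auto simp: kron_mult[of _ 2 _ ?N] mult_square(1)[of _ 2] mult_square(1)[of _ ?N] intro!: msum_cong\<close>)
  have term_le: "cmod (mtrace (pauli a * pauli b * (pauli c * pauli d)) * mtrace (G a * G b * (G c * G d)))
      \<le> 2 * (if three_zeros a b c d then 0 else x a * x b * (x c * x d))" for a b c d
  proof (cases "three_zeros a b c d")
    case False
    have "cmod (mtrace (G a * G b * (G c * G d))) \<le> x a * x b * (x c * x d)"
      using cmod_mtrace_four_le[OF G G G G] by (simp add: x_def mult.assoc)
    thus ?thesis using cmod_mtrace_pauli_four_le[of a b c d] False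
      by (simp add: norm_mult mult_mono)
  qed (simp add: mtrace_pauli_four_eq_0)
  have "complex_of_real ((frob (F * F))\<^sup>2) = mtrace (F * F * (F * F))"
    using mtrace_adjoint_mult[OF mult_square(1)[OF Fc(1) Fc(1)]] by (simp add: mat_adjoint_mult[OF Fc(1) Fc(1)] Fc)
  also have "\<dots> = (\<Sum>((a, b), (c, d))\<in>({..<4} \<times> {..<4}) \<times> ({..<4} \<times> {..<4}).
      mtrace (pauli a * pauli b * (pauli c * pauli d)) * mtrace (G a * G b * (G c * G d)))"
    unfolding FFFF
    by (subst mtrace_msum) (use G in \<open>auto intro!: sum.cong kron_carrier mult_square(1)
      mtrace_kron[of _ 2 _ ?N]\<close>)
  also have "\<dots> = (\<Sum>a<4. \<Sum>b<4. \<Sum>c<4. \<Sum>d<4.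
      mtrace (pauli a * pauli b * (pauli c * pauli d)) * mtrace (G a * G b * (G c * G d)))"
    by (simp add: sum.cartesian_product')
  finally have "(frob (F * F))\<^sup>2 = cmod \<dots>"
    by (metis norm_of_real abs_power2)
  also have "\<dots> \<le> (\<Sum>a<4. \<Sum>b<4. \<Sum>c<4. \<Sum>d<4.
      2 * (if three_zeros a b c d then 0 else x a * x b * (x c * x d)))"
    by (intro sum_norm_le term_le)
  also have "\<dots> = 2 * (\<Sum>a<4. \<Sum>b<4. \<Sum>c<4. \<Sum>d<4.
      (if three_zeros a b c d then 0 else x a * x b * (x c * x d)))"
    by (simp only: sum_distrib_left)
  also have "\<dots> \<le> 2 * ((x 0)\<^sup>2 + 16 * ((x 1)\<^sup>2 + (x 2)\<^sup>2 + (x 3)\<^sup>2))\<^sup>2"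
    using sum_four_le[OF x0] by simp
  also have "\<dots> \<le> 2 * (sqrt (2 ^ n) * (S 0 + 16 * (S 1 + S 2 + S 3)))\<^sup>2"
    using xS[of 0] xS[of 1] xS[of 2] xS[of 3]
    by (intro mult_left_mono power_mono) (simp_all add: algebra_simps)
  \<comment> \<open>The factor 2 from the one-qubit trace is exactly the change of normalisation
    from \<open>n\<close> to \<open>Suc n\<close> qubits, so no constant accumulates in the
    induction.\<close>
  also have "\<dots> = (sqrt (2 ^ Suc n) * (S 0 + 16 * (S 1 + S 2 + S 3)))\<^sup>2"
    by (simp add: power_mult_distrib)
  also have "S 0 + 16 * (S 1 + S 2 + S 3) = (\<Sum>s\<in>pauli_indices (Suc n). 16 ^ pauli_weight s * (c s)\<^sup>2)"
    unfolding sum_pauli_indices_Suc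
    by (simp add: S_def sum_lessThan_4 sum_distrib_left mult.assoc algebra_simps)
  finally show ?case
    unfolding F_def[symmetric] by (rule power2_le_imp_le) (auto intro!: mult_nonneg_nonneg sum_nonneg)
qed

section \<open>Qubit differences and local Pauli operators\<close>

text \<open>Linearity is expressed by the values on matrix units, since these are the data from
  which \<open>map_tensor\<close> is built.\<close>

definition linear_map :: "nat \<Rightarrow> (complex mat \<Rightarrow> complex mat) \<Rightarrow> bool" where
  "linear_map d \<Phi> \<longleftrightarrow> (\<forall>X\<in>carrier_mat d d. \<Phi> X \<in> carrier_mat d d \<and> (\<forall>p<d. \<forall>q<d.
     \<Phi> X $$ (p, q) = (\<Sum>i<d. \<Sum>j<d. X $$ (i, j) * \<Phi> (matrix_unit d i j) $$ (p, q))))"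

lemma linear_mapD:
  assumes "linear_map d \<Phi>" "X \<in> carrier_mat d d"
  shows "\<Phi> X \<in> carrier_mat d d"
    "p < d \<Longrightarrow> q < d \<Longrightarrow> \<Phi> X $$ (p, q) = (\<Sum>i<d. \<Sum>j<d. X $$ (i, j) * \<Phi> (matrix_unit d i j) $$ (p, q))"
  using assms unfolding linear_map_def by blast+

lemma matrix_unit_carrier [simp]: "matrix_unit d i j \<in> carrier_mat d d"
  "dim_row (matrix_unit d i j) = d" "dim_col (matrix_unit d i j) = d"
  by (auto simp: matrix_unit_def)

lemma matrix_unit_index: "k < d \<Longrightarrow> l < d \<Longrightarrow> matrix_unit d i j $$ (k, l) = (if k = i \<and> l = j then 1 else 0)"
  by (simp add: matrix_unit_def)

lemma sum_matrix_unit: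
  fixes p q d :: nat
  assumes "p < d" "q < d"
  shows "(\<Sum>i<d. \<Sum>j<d. X i j * (if p = i \<and> q = j then 1 else 0)) = (X p q :: complex)"
proof -
  have "(\<Sum>j<d. X i j * (if p = i \<and> q = j then 1 else 0)) = (if p = i then X i q else 0)" for i
    using assms by (cases "p = i") (simp_all add: if_distrib[of "(*) _"] cong: if_cong)
  thus ?thesis using assms by simp
qed

lemma linear_map_id: "linear_map d (\<lambda>X. X)"
  unfolding linear_map_def by (simp add: matrix_unit_index sum_matrix_unit)

lemma linear_map_traceless: "linear_map 2 (\<lambda>X. X - (mtrace X / 2) \<cdot>\<^sub>m 1\<^sub>m 2)"
  unfolding linear_map_def
  by (auto simp: mtrace_def sum_lessThan_2 matrix_unit_index less_2_cases_iff field_simps)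

lemma map_tensor_carrier [simp]: "map_tensor a b \<Phi> \<Psi> X \<in> carrier_mat (a * b) (a * b)"
  by (simp add: map_tensor_def)

lemma map_tensor_index:
  assumes "p < a * b" "q < a * b" "linear_map a \<Phi>" "linear_map b \<Psi>"
  shows "map_tensor a b \<Phi> \<Psi> X $$ (p, q) = (\<Sum>i<a. \<Sum>j<a. \<Sum>k<b. \<Sum>l<b. X $$ (i * b + k, j * b + l) *
      (\<Phi> (matrix_unit a i j) $$ (p div b, q div b) * \<Psi> (matrix_unit b k l) $$ (p mod b, q mod b)))"
proof -
  have \<Phi>: "\<Phi> (matrix_unit a i j) \<in> carrier_mat a a" and \<Psi>: "\<Psi> (matrix_unit b i j) \<in> carrier_mat b b" for i j
    using assms by (auto simp: linear_map_def)
  have K: "(c \<cdot>\<^sub>m kron (\<Phi> (matrix_unit a i j)) (\<Psi> (matrix_unit b k l))) $$ (p, q)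
      = c * (\<Phi> (matrix_unit a i j) $$ (p div b, q div b) * \<Psi> (matrix_unit b k l) $$ (p mod b, q mod b))" for i j k l c
    using assms(1,2) carrier_matD[OF \<Phi>[of i j]] carrier_matD[OF \<Psi>[of k l]]
    by (simp add: kron_index[OF \<Phi> \<Psi>])
  show ?thesis
    unfolding map_tensor_def msum_index[OF assms(1,2)] sum.cartesian_product
    by (intro sum.cong) (auto simp: K)
qed

text \<open>\<open>qubit_diff\<close> nests two tensor products of maps, so the inner one must again
  qualify as a factor. The same fact lets \<open>qubit_diff\<close> be applied to a Pauli expansion
  term by term.\<close>

lemma linear_map_tensor:
  assumes "linear_map a \<Phi>" "linear_map b \<Psi>"
  shows "linear_map (a * b) (map_tensor a b \<Phi> \<Psi>)"
  unfolding linear_map_def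
proof (intro ballI conjI allI impI)
  fix X :: "complex mat" and p q assume pq: "p < a * b" "q < a * b"
  let ?K = "\<lambda>i j k l. \<Phi> (matrix_unit a i j) $$ (p div b, q div b) * \<Psi> (matrix_unit b k l) $$ (p mod b, q mod b)"
  let ?E = "\<lambda>u v (i, j, k, l). matrix_unit (a * b) u v $$ (i * b + k, j * b + l) * ?K i j k l"
  let ?I = "{..<a} \<times> {..<a} \<times> {..<b} \<times> {..<b}"
  have "(\<Sum>u<a * b. \<Sum>v<a * b. X $$ (u, v) * map_tensor a b \<Phi> \<Psi> (matrix_unit (a * b) u v) $$ (p, q))
     = (\<Sum>u<a * b. \<Sum>v<a * b. \<Sum>x\<in>?I. X $$ (u, v) * ?E u v x)"
    unfolding map_tensor_index[OF pq assms] sum.cartesian_product sum_distrib_left ..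
  also have "\<dots> = (\<Sum>x\<in>?I. \<Sum>u<a * b. \<Sum>v<a * b. X $$ (u, v) * ?E u v x)"
    by (subst sum.swap[of _ ?I], subst sum.swap[of _ ?I]) (rule refl)
  also have "\<dots> = (\<Sum>(i, j, k, l)\<in>?I. (\<Sum>u<a * b. \<Sum>v<a * b. X $$ (u, v) *
      (if i * b + k = u \<and> j * b + l = v then 1 else 0)) * ?K i j k l)"
    unfolding sum_distrib_right by (intro sum.cong refl) (auto simp: matrix_unit_index pair_index_less intro!: sum.cong)
  also have "\<dots> = (\<Sum>(i, j, k, l)\<in>?I. X $$ (i * b + k, j * b + l) * ?K i j k l)"
    by (intro sum.cong refl) (auto simp: sum_matrix_unit pair_index_less)
  also have "\<dots> = map_tensor a b \<Phi> \<Psi> X $$ (p, q)"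
    unfolding map_tensor_index[OF pq assms] sum.cartesian_product ..
  finally show "map_tensor a b \<Phi> \<Psi> X $$ (p, q) =
    (\<Sum>u<a * b. \<Sum>v<a * b. X $$ (u, v) * map_tensor a b \<Phi> \<Psi> (matrix_unit (a * b) u v) $$ (p, q))" ..
qed simp

lemma map_tensor_kron:
  assumes L: "linear_map a \<Phi>" "linear_map b \<Psi>" and A: "A \<in> carrier_mat a a" and B: "B \<in> carrier_mat b b"
  shows "map_tensor a b \<Phi> \<Psi> (kron A B) = kron (\<Phi> A) (\<Psi> B)"
proof (rule eq_matI)
  have \<Phi>: "\<Phi> A \<in> carrier_mat a a" and \<Psi>: "\<Psi> B \<in> carrier_mat b b"
    using assms by (auto simp: linear_map_def)
  thus "dim_row (map_tensor a b \<Phi> \<Psi> (kron A B)) = dim_row (kron (\<Phi> A) (\<Psi> B))"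
    "dim_col (map_tensor a b \<Phi> \<Psi> (kron A B)) = dim_col (kron (\<Phi> A) (\<Psi> B))"
    using carrier_matD[OF map_tensor_carrier[of a b \<Phi> \<Psi> "kron A B"]] by simp_all
  fix p q assume "p < dim_row (kron (\<Phi> A) (\<Psi> B))" "q < dim_col (kron (\<Phi> A) (\<Psi> B))"
  hence pq: "p < a * b" "q < a * b" using \<Phi> \<Psi> by auto
  note d = div_mod_less[OF pq(1)] div_mod_less[OF pq(2)]
  have "map_tensor a b \<Phi> \<Psi> (kron A B) $$ (p, q) = (\<Sum>i<a. \<Sum>j<a. \<Sum>k<b. \<Sum>l<b.
      (A $$ (i, j) * \<Phi> (matrix_unit a i j) $$ (p div b, q div b)) *
      (B $$ (k, l) * \<Psi> (matrix_unit b k l) $$ (p mod b, q mod b)))"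
    unfolding map_tensor_index[OF pq L]
    by (intro sum.cong refl) (auto simp: kron_index[OF A B] pair_index_less)
  also have "\<dots> = (\<Sum>i<a. \<Sum>j<a. A $$ (i, j) * \<Phi> (matrix_unit a i j) $$ (p div b, q div b)) *
      (\<Sum>k<b. \<Sum>l<b. B $$ (k, l) * \<Psi> (matrix_unit b k l) $$ (p mod b, q mod b))"
    by (simp only: sum_distrib_left[symmetric] sum_distrib_right[symmetric])
  also have "\<dots> = \<Phi> A $$ (p div b, q div b) * \<Psi> B $$ (p mod b, q mod b)"
    unfolding linear_mapD(2)[OF L(1) A d(1,3)] linear_mapD(2)[OF L(2) B d(2,4)] ..
  finally show "map_tensor a b \<Phi> \<Psi> (kron A B) $$ (p, q) = kron (\<Phi> A) (\<Psi> B) $$ (p, q)"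
    unfolding kron_index[OF \<Phi> \<Psi> pq] .
qed

lemma linear_map_msum:
  assumes L: "linear_map d \<Phi>" and M: "\<And>s. s \<in> S \<Longrightarrow> M s \<in> carrier_mat d d"
  shows "\<Phi> (msum d (\<lambda>s. c s \<cdot>\<^sub>m M s) S) = msum d (\<lambda>s. c s \<cdot>\<^sub>m \<Phi> (M s)) S"
proof (rule eq_matI)
  let ?X = "msum d (\<lambda>s. c s \<cdot>\<^sub>m M s) S"
  have X: "\<Phi> ?X \<in> carrier_mat d d" using L by (simp add: linear_map_def)
  thus "dim_row (\<Phi> ?X) = dim_row (msum d (\<lambda>s. c s \<cdot>\<^sub>m \<Phi> (M s)) S)"
    "dim_col (\<Phi> ?X) = dim_col (msum d (\<lambda>s. c s \<cdot>\<^sub>m \<Phi> (M s)) S)" by auto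
  fix p q assume "p < dim_row (msum d (\<lambda>s. c s \<cdot>\<^sub>m \<Phi> (M s)) S)" "q < dim_col (msum d (\<lambda>s. c s \<cdot>\<^sub>m \<Phi> (M s)) S)"
  hence pq: "p < d" "q < d" by auto
  have lin: "\<Phi> X $$ (p, q) = (\<Sum>i<d. \<Sum>j<d. X $$ (i, j) * \<Phi> (matrix_unit d i j) $$ (p, q))"
    and car: "\<Phi> X \<in> carrier_mat d d" if "X \<in> carrier_mat d d" for X
    using linear_mapD[OF L that] pq by blast+
  have Mi: "(c s \<cdot>\<^sub>m M s) $$ (i, j) = c s * M s $$ (i, j)" if "s \<in> S" "i < d" "j < d" for s i j
    using carrier_matD[OF M[OF that(1)]] that by simp
  have "\<Phi> ?X $$ (p, q) = (\<Sum>i<d. \<Sum>j<d. \<Sum>s\<in>S. c s * (M s $$ (i, j) * \<Phi> (matrix_unit d i j) $$ (p, q)))"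
    unfolding lin[OF msum_carrier(1)] by (intro sum.cong refl) (auto simp: msum_index Mi sum_distrib_right mult.assoc intro!: sum.cong)
  also have "\<dots> = (\<Sum>s\<in>S. c s * (\<Sum>i<d. \<Sum>j<d. M s $$ (i, j) * \<Phi> (matrix_unit d i j) $$ (p, q)))"
    unfolding sum_distrib_left by (subst sum.swap[of _ S], subst sum.swap[of _ S]) (rule refl)
  also have "\<dots> = (\<Sum>s\<in>S. (c s \<cdot>\<^sub>m \<Phi> (M s)) $$ (p, q))"
  proof (intro sum.cong refl)
    fix s assume s: "s \<in> S"
    show "c s * (\<Sum>i<d. \<Sum>j<d. M s $$ (i, j) * \<Phi> (matrix_unit d i j) $$ (p, q)) = (c s \<cdot>\<^sub>m \<Phi> (M s)) $$ (p, q)"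
      using carrier_matD[OF car[OF M[OF s]]] pq by (simp add: lin[OF M[OF s]])
  qed
  finally show "\<Phi> ?X $$ (p, q) = msum d (\<lambda>s. c s \<cdot>\<^sub>m \<Phi> (M s)) S $$ (p, q)"
    by (simp add: msum_index pq)
qed

text \<open>Qubits count from 1 and list positions from 0, hence \<open>j - 1\<close>; the three
  pieces match the three tensor factors in \<open>qubit_diff\<close>.\<close>

lemma split_at_qubit:
  assumes "s \<in> pauli_indices n" "1 \<le> j" "j \<le> n"
  obtains s1 s2 where "s = s1 @ s ! (j - 1) # s2" "length s1 = j - 1" "length s2 = n - j"
proof
  have l: "length s = n" using pauli_indicesD(1)[OF assms(1)] .
  show "s = take (j - 1) s @ s ! (j - 1) # drop j s"
    using id_take_nth_drop[of "j - 1" s] assms l by simp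
qed (use assms pauli_indicesD(1)[OF assms(1)] in auto)

lemma dim_split:
  assumes "1 \<le> j" "j \<le> n"
  shows "2 ^ (j - 1) * (2 * 2 ^ (n - j)) = (2 ^ n :: nat)"
proof -
  have "2 ^ (j - 1) * (2 * 2 ^ (n - j)) = (2 ^ (j - 1 + Suc (n - j)) :: nat)"
    by (simp only: power_add power_Suc)
  also have "j - 1 + Suc (n - j) = n" using assms by simp
  finally show ?thesis .
qed

text \<open>On one qubit the map kills the identity and fixes the traceless Paulis, so Pauli strings
  are eigenvectors with eigenvalue 0 or 1.\<close>

lemma qubit_diff_pauli_tensor:
  assumes "s \<in> pauli_indices n" "1 \<le> j" "j \<le> n"
  shows "qubit_diff n j (pauli_tensor s) = (if s ! (j - 1) = 0 then 0 else 1) \<cdot>\<^sub>m pauli_tensor s"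
proof -
  define k where "k = s ! (j - 1)"
  obtain s1 s2 where s: "s = s1 @ k # s2" "length s1 = j - 1" "length s2 = n - j"
    using split_at_qubit[OF assms] unfolding k_def .
  let ?\<Delta> = "\<lambda>X. X - (mtrace X / 2) \<cdot>\<^sub>m 1\<^sub>m 2 :: complex mat"
  have c1: "pauli_tensor s1 \<in> carrier_mat (2 ^ (j - 1)) (2 ^ (j - 1))"
    and c2: "pauli_tensor s2 \<in> carrier_mat (2 ^ (n - j)) (2 ^ (n - j))"
    using pauli_tensor_carrier_length[of s1] pauli_tensor_carrier_length[of s2] s by auto
  have T: "pauli_tensor s = kron (pauli_tensor s1) (kron (pauli k) (pauli_tensor s2))"
    unfolding s(1) pauli_tensor_append pauli_tensor_simps ..
  have \<Delta>: "?\<Delta> (pauli k) = (if k = 0 then 0 else 1) \<cdot>\<^sub>m pauli k"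
    by (rule eq_matI) (auto simp: mtrace_pauli pauli_zero mtrace_one)
  have "qubit_diff n j (pauli_tensor s) = kron (pauli_tensor s1) (kron (?\<Delta> (pauli k)) (pauli_tensor s2))"
    unfolding T qubit_diff_def
    by (simp add: map_tensor_kron linear_map_id linear_map_traceless linear_map_tensor c1 c2 del: One_nat_def)
  also have "\<dots> = (if k = 0 then 0 else 1) \<cdot>\<^sub>m pauli_tensor s"
    unfolding \<Delta> T
    by (simp only: kron_smult_left[OF pauli_carrier(1) c2] kron_smult_right[OF c1 kron_carrier[OF pauli_carrier(1) c2]])
  finally show ?thesis by (simp add: k_def)
qed

lemma qubit_diff_pauli_sum:
  assumes "1 \<le> j" "j \<le> n"
  shows "qubit_diff n j (pauli_sum n c) = pauli_sum n (\<lambda>s. if s ! (j - 1) = 0 then 0 else c s)"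
proof -
  have L: "linear_map (2 ^ n) (qubit_diff n j)"
    unfolding qubit_diff_def dim_split[OF assms, symmetric]
    by (intro linear_map_tensor linear_map_id linear_map_traceless)
  have "qubit_diff n j (pauli_sum n c) =
      msum (2 ^ n) (\<lambda>s. c s \<cdot>\<^sub>m qubit_diff n j (pauli_tensor s)) (pauli_indices n)"
    unfolding pauli_sum_def by (rule linear_map_msum[OF L]) simp
  also have "\<dots> = pauli_sum n (\<lambda>s. if s ! (j - 1) = 0 then 0 else c s)"
    unfolding pauli_sum_def
    by (rule msum_cong, subst qubit_diff_pauli_tensor[OF _ assms]) (auto intro!: eq_matI)
  finally show ?thesis .
qed

text \<open>A probe for dependence on qubit \<open>j\<close>: an operator that commutes with these
  for all \<open>k \<le> 3\<close> has no string that is nontrivial at \<open>j\<close>.\<close>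

definition local_pauli :: "nat \<Rightarrow> nat \<Rightarrow> nat \<Rightarrow> complex mat" where
  "local_pauli n j k = kron (1\<^sub>m (2 ^ (j - 1))) (kron (pauli k) (1\<^sub>m (2 ^ (n - j))))"

lemma local_pauli:
  assumes "1 \<le> j" "j \<le> n"
  shows local_pauli_carrier: "local_pauli n j k \<in> carrier_mat (2 ^ n) (2 ^ n)"
    and local_pauli_square: "local_pauli n j k * local_pauli n j k = 1\<^sub>m (2 ^ n)"
proof -
  have K: "kron (pauli k) (1\<^sub>m (2 ^ (n - j))) \<in> carrier_mat (2 * 2 ^ (n - j)) (2 * 2 ^ (n - j))" by simp
  show "local_pauli n j k \<in> carrier_mat (2 ^ n) (2 ^ n)"
    unfolding local_pauli_def dim_split[OF assms, symmetric] by (intro kron_carrier K) simp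
  show "local_pauli n j k * local_pauli n j k = 1\<^sub>m (2 ^ n)"
    unfolding local_pauli_def dim_split[OF assms, symmetric]
    by (simp add: kron_mult[OF one_carrier_mat K one_carrier_mat K] pauli_square kron_one_one
      kron_mult[OF pauli_carrier(1) one_carrier_mat pauli_carrier(1) one_carrier_mat])
qed

lemma local_pauli_commute:
  assumes "s \<in> pauli_indices n" "1 \<le> j" "j \<le> n" "k \<le> 3"
  shows "local_pauli n j k * pauli_tensor s =
    (if k = 0 \<or> s ! (j - 1) = 0 \<or> s ! (j - 1) = k then 1 else - 1) \<cdot>\<^sub>m (pauli_tensor s * local_pauli n j k)"
proof -
  define l where "l = s ! (j - 1)"
  have l: "l \<le> 3" unfolding l_def using pauli_indicesD(2)[OF assms(1)] assms by auto
  obtain s1 s2 where s: "s = s1 @ l # s2" "length s1 = j - 1" "length s2 = n - j"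
    using split_at_qubit[OF assms(1-3)] unfolding l_def .
  have c1: "pauli_tensor s1 \<in> carrier_mat (2 ^ (j - 1)) (2 ^ (j - 1))"
    and c2: "pauli_tensor s2 \<in> carrier_mat (2 ^ (n - j)) (2 ^ (n - j))"
    using pauli_tensor_carrier_length[of s1] pauli_tensor_carrier_length[of s2] s by auto
  have K: "kron M (1\<^sub>m (2 ^ (n - j))) \<in> carrier_mat (2 * 2 ^ (n - j)) (2 * 2 ^ (n - j))"
    "kron M (pauli_tensor s2) \<in> carrier_mat (2 * 2 ^ (n - j)) (2 * 2 ^ (n - j))" if "M \<in> carrier_mat 2 2" for M
    using that c2 by auto
  note K' = K[OF pauli_carrier(1)]
  have T: "pauli_tensor s = kron (pauli_tensor s1) (kron (pauli l) (pauli_tensor s2))"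
    unfolding s(1) pauli_tensor_append pauli_tensor_simps ..
  have 1: "local_pauli n j k * pauli_tensor s = kron (pauli_tensor s1) (kron (pauli k * pauli l) (pauli_tensor s2))"
    unfolding T local_pauli_def
    using kron_mult[OF one_carrier_mat K'(1) c1 K'(2), of k l] kron_mult[OF pauli_carrier(1) one_carrier_mat pauli_carrier(1) c2, of k l]
    by (simp add: left_mult_one_mat[OF c1] left_mult_one_mat[OF c2] del: One_nat_def)
  have 2: "pauli_tensor s * local_pauli n j k = kron (pauli_tensor s1) (kron (pauli l * pauli k) (pauli_tensor s2))"
    unfolding T local_pauli_def
    using kron_mult[OF c1 K'(2) one_carrier_mat K'(1), of l k] kron_mult[OF pauli_carrier(1) c2 pauli_carrier(1) one_carrier_mat, of l k]
    by (simp add: right_mult_one_mat[OF c1] right_mult_one_mat[OF c2] del: One_nat_def)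
  have lk: "pauli l * pauli k \<in> carrier_mat 2 2" by (simp add: mult_square(1)[of _ 2])
  show ?thesis
    unfolding 1 2 l_def[symmetric]
    by (subst pauli_commute[OF assms(4) l]) (auto simp: kron_smult_left[OF lk c2] kron_smult_right[OF c1 K(2)[OF lk]])
qed

section \<open>Unitary changes of basis and trace duality\<close>

lemma unitary_conj_mult:
  assumes U: "unitary_mat n U" and M: "M \<in> carrier_mat n n" and N: "N \<in> carrier_mat n n"
  shows "(mat_adjoint U * M * U) * (mat_adjoint U * N * U) = mat_adjoint U * (M * N) * U"
proof -
  note U' = unitary_matD[OF U]
  have "(mat_adjoint U * M * U) * (mat_adjoint U * N * U) = mat_adjoint U * (M * (U * (mat_adjoint U * (N * U))))"
    using U'(1,2) M N by (simp add: mult_square[of _ n])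
  also have "U * (mat_adjoint U * (N * U)) = N * U"
    by (rule unitary_mat_cancel(2)[OF U, of _ n]) (use U' N in \<open>auto intro: mult_square(1)\<close>)
  finally show ?thesis using U'(1,2) M N by (simp add: mult_square[of _ n])
qed

lemma unitary_conj_adjoint:
  assumes U: "unitary_mat n U" and M: "M \<in> carrier_mat n n"
  shows "mat_adjoint (mat_adjoint U * M * U) = mat_adjoint U * mat_adjoint M * U"
  using unitary_matD(1,2)[OF U] M
  by (simp add: mat_adjoint_mult[of _ n n _ n] mult_square[of _ n])

lemma unitary_conj_carrier:
  assumes "unitary_mat n U" "M \<in> carrier_mat n n"
  shows "mat_adjoint U * M * U \<in> carrier_mat n n"
  using unitary_matD(1,2)[OF assms(1)] assms(2) by (intro mult_square(1))

lemma frob_unitary_conj: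
  assumes U: "unitary_mat n U" and M: "M \<in> carrier_mat n n"
  shows "frob (mat_adjoint U * M * U) = frob M"
proof -
  note U' = unitary_matD[OF U]
  let ?K = "mat_adjoint U * M * U"
  have K: "?K \<in> carrier_mat n n" by (rule unitary_conj_carrier[OF U M])
  have MM: "M * mat_adjoint M \<in> carrier_mat n n" using M by (intro mult_square(1)) auto
  have "complex_of_real ((frob ?K)\<^sup>2) = mtrace (mat_adjoint U * (M * mat_adjoint M) * U)"
    unfolding mtrace_adjoint_mult[OF K, symmetric] unitary_conj_adjoint[OF U M]
    using unitary_conj_mult[OF U M mat_adjoint_carrier[OF M]] by simp
  also have "\<dots> = mtrace (U * (mat_adjoint U * (M * mat_adjoint M)))"
    by (rule mtrace_comm[of _ n n]) (use U' MM in \<open>auto intro: mult_square(1)\<close>)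
  also have "\<dots> = complex_of_real ((frob M)\<^sup>2)"
    by (simp only: unitary_mat_cancel(2)[OF U MM] mtrace_adjoint_mult[OF M])
  finally have "(frob ?K)\<^sup>2 = (frob M)\<^sup>2" by (simp only: of_real_eq_iff)
  thus ?thesis using frob_nonneg power2_eq_iff_nonneg by blast
qed

text \<open>Entry \<open>(i, i)\<close> of the square is the sum of the squared moduli along row
  \<open>i\<close>, one of which belongs to the diagonal entry.\<close>

lemma hermitian_square_diag:
  assumes "K \<in> carrier_mat n n" "mat_adjoint K = K" "i < n"
  shows "(cmod (K $$ (i, i)))\<^sup>2 \<le> cmod ((K * K) $$ (i, i))"
proof -
  have "(K * K) $$ (i, i) = (\<Sum>j<n. K $$ (i, j) * K $$ (j, i))"
    using mult_index[OF assms(1,1,3,3)] .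
  also have "\<dots> = complex_of_real (\<Sum>j<n. (cmod (K $$ (i, j)))\<^sup>2)"
    unfolding of_real_sum
    by (intro sum.cong refl)
      (simp only: hermitian_index[OF assms, symmetric] lessThan_iff complex_norm_square)
  finally have "cmod ((K * K) $$ (i, i)) = (\<Sum>j<n. (cmod (K $$ (i, j)))\<^sup>2)"
    by (simp only: norm_of_real) (simp add: sum_nonneg)
  moreover have "(cmod (K $$ (i, i)))\<^sup>2 \<le> (\<Sum>j<n. (cmod (K $$ (i, j)))\<^sup>2)"
    using assms(3) by (intro member_le_sum) auto
  ultimately show ?thesis by simp
qed

lemma quantum_booleanD:
  assumes "quantum_boolean n A"
  shows "A \<in> carrier_mat (2 ^ n) (2 ^ n)" "mat_adjoint A = A" "A * A = 1\<^sub>m (2 ^ n)"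
  using assms by (auto simp: quantum_boolean_def)

text \<open>Duality of trace norm and operator norm. In an eigenbasis of \<open>f\<close> the
  operator \<open>A\<close> still squares to the identity, so its diagonal entries have modulus at
  most 1.\<close>

lemma mtrace_boolean_le:
  assumes A: "quantum_boolean n A" and f: "f \<in> carrier_mat (2 ^ n) (2 ^ n)" "mat_adjoint f = f"
  shows "Re (mtrace (f * A)) / 2 ^ n \<le> schatten n 1 f"
proof -
  note A' = quantum_booleanD[OF A]
  obtain U e where U: "unitary_mat (2 ^ n) U" and fe: "f = diag_conj (2 ^ n) U (\<lambda>i. complex_of_real (e i))"
    using hermitian_diagonalization[OF f] by auto
  note U' = unitary_matD[OF U]
  define K where "K = mat_adjoint U * A * U"
  have K: "K \<in> carrier_mat (2 ^ n) (2 ^ n)" "mat_adjoint K = K" "K * K = 1\<^sub>m (2 ^ n)"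
    unfolding K_def unitary_conj_adjoint[OF U A'(1)] unitary_conj_mult[OF U A'(1,1)] A'(2,3)
    using U' by (simp_all add: unitary_conj_carrier[OF U A'(1)] right_mult_one_mat[OF U'(2)])
  have K1: "cmod (K $$ (i, i)) \<le> 1" if "i < 2 ^ n" for i
    using hermitian_square_diag[OF K(1,2) that] that
    by (simp add: K(3) power_le_one_iff abs_square_le_1[symmetric] del: index_mult_mat(1))
  have "Re (mtrace (f * A)) \<le> cmod (\<Sum>i<2 ^ n. complex_of_real (e i) * K $$ (i, i))"
    unfolding fe mtrace_diag_conj_mult[OF U'(1) A'(1)] K_def by (rule complex_Re_le_cmod)
  also have "\<dots> \<le> (\<Sum>i<2 ^ n. \<bar>e i\<bar>)"
    by (rule sum_norm_le) (use K1 in \<open>auto simp: norm_mult mult_left_le\<close>)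
  finally show ?thesis
    unfolding schatten_one_diag_conj[OF U fe] by (simp add: divide_right_mono)
qed

lemma schatten_two_pauli_sum:
  "(schatten n 2 (pauli_sum n (\<lambda>s. complex_of_real (c s))))\<^sup>2 = (\<Sum>s\<in>pauli_indices n. (c s)\<^sup>2)"
  unfolding schatten_two_power2(1)[OF pauli_sum_carrier(1) mat_adjoint_pauli_sum] mtrace_pauli_sum_mult
  by (simp add: power2_eq_square)

text \<open>
  The dual form of hypercontractivity. Pairing \<open>f\<close> with \<open>g\<close>, whose coefficients are damped by
  \<open>16\<close> to the weight, and bounding the square of \<open>tr (f g)\<close> by \<open>tr \<bar>f\<bar>\<close> times \<open>tr (\<bar>f\<bar> g\<^sup>2)\<close> in an
  eigenbasis of \<open>f\<close> avoids the non-integer Schatten norms of the usual argument.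
\<close>

lemma damped_weight_le:
  fixes c :: "nat list \<Rightarrow> real" and n :: nat
  defines "f \<equiv> pauli_sum n (\<lambda>s. complex_of_real (c s))"
  shows "(\<Sum>s\<in>pauli_indices n. (c s)\<^sup>2 / 16 ^ pauli_weight s) \<le> schatten n 1 f * schatten n 2 f"
proof -
  let ?N = "2 ^ n :: nat"
  define S where "S = (\<Sum>s\<in>pauli_indices n. (c s)\<^sup>2 / 16 ^ pauli_weight s)"
  \<comment> \<open>The damping makes the estimate close on itself: the normalised trace of
    \<open>f * g\<close> and the hypercontractive sum for \<open>g\<close> are both equal to
    \<open>S\<close>.\<close>
  define g where "g = pauli_sum n (\<lambda>s. complex_of_real (c s / 16 ^ pauli_weight s))"
  have f: "f \<in> carrier_mat ?N ?N" "mat_adjoint f = f" by (simp_all add: f_def mat_adjoint_pauli_sum)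
  have g: "g \<in> carrier_mat ?N ?N" "mat_adjoint g = g"
    unfolding g_def by (rule pauli_sum_carrier, rule mat_adjoint_pauli_sum)
  obtain U e where U: "unitary_mat ?N U" and fe: "f = diag_conj ?N U (\<lambda>i. complex_of_real (e i))"
    using hermitian_diagonalization[OF f] by auto
  note U' = unitary_matD[OF U]
  define G where "G = mat_adjoint U * g * U"
  have G: "G \<in> carrier_mat ?N ?N" "mat_adjoint G = G"
    unfolding G_def unitary_conj_adjoint[OF U g(1)] g(2) using unitary_conj_carrier[OF U g(1)] by auto
  have S0: "S \<ge> 0" unfolding S_def by (intro sum_nonneg) auto
  have GG: "frob (G * G) \<le> sqrt (2 ^ n) * S"
  proof -
    have "G * G = mat_adjoint U * (g * g) * U" unfolding G_def by (rule unitary_conj_mult[OF U g(1,1)])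
    hence "frob (G * G) = frob (g * g)"
      using frob_unitary_conj[OF U mult_square(1)[OF g(1,1)]] by simp
    also have "\<dots> \<le> sqrt (2 ^ n) * (\<Sum>s\<in>pauli_indices n. 16 ^ pauli_weight s * (c s / 16 ^ pauli_weight s)\<^sup>2)"
      unfolding g_def by (rule pauli_hypercontractivity)
    also have "(\<Sum>s\<in>pauli_indices n. 16 ^ pauli_weight s * (c s / 16 ^ pauli_weight s)\<^sup>2) = S"
      unfolding S_def by (intro sum.cong) (auto simp: power2_eq_square)
    finally show ?thesis .
  qed
  let ?d = "\<lambda>i. cmod (G $$ (i, i))"
  have "2 ^ n * S = Re (mtrace (f * g))"
    unfolding f_def g_def mtrace_pauli_sum_mult S_def by (simp add: power2_eq_square)
  also have "\<dots> \<le> cmod (\<Sum>i<?N. complex_of_real (e i) * G $$ (i, i))"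
    unfolding fe mtrace_diag_conj_mult[OF U'(1) g(1)] G_def by (rule complex_Re_le_cmod)
  also have "\<dots> \<le> (\<Sum>i<?N. \<bar>e i\<bar> * ?d i)"
    by (rule sum_norm_le) (simp add: norm_mult)
  also have "\<dots> = (\<Sum>i<?N. \<bar>sqrt \<bar>e i\<bar>\<bar> * \<bar>sqrt \<bar>e i\<bar> * ?d i\<bar>)"
    by (intro sum.cong) (auto simp: abs_mult)
  also have "\<dots> \<le> L2_set (\<lambda>i. sqrt \<bar>e i\<bar>) {..<?N} * L2_set (\<lambda>i. sqrt \<bar>e i\<bar> * ?d i) {..<?N}"
    by (rule L2_set_mult_ineq)
  also have "\<dots> = sqrt ((\<Sum>i<?N. \<bar>e i\<bar>) * (\<Sum>i<?N. \<bar>e i\<bar> * (?d i)\<^sup>2))"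
    by (simp add: L2_set_def power_mult_distrib real_sqrt_mult)
  finally have "(2 ^ n * S)\<^sup>2 \<le> (sqrt ((\<Sum>i<?N. \<bar>e i\<bar>) * (\<Sum>i<?N. \<bar>e i\<bar> * (?d i)\<^sup>2)))\<^sup>2"
    by (rule power_mono) (simp add: S0)
  also have "\<dots> = (\<Sum>i<?N. \<bar>e i\<bar>) * (\<Sum>i<?N. \<bar>e i\<bar> * (?d i)\<^sup>2)"
    by (intro real_sqrt_pow2 mult_nonneg_nonneg sum_nonneg) auto
  also have "\<dots> \<le> (\<Sum>i<?N. \<bar>e i\<bar>) * (sqrt (\<Sum>i<?N. (e i)\<^sup>2) * (sqrt (2 ^ n) * S))"
  proof (intro mult_left_mono)
    \<comment> \<open>The square of a diagonal entry of \<open>G\<close> is replaced by a diagonal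
      entry of \<open>G * G\<close>; Cauchy-Schwarz then yields the 2-norm of \<open>f\<close> and a
      Frobenius norm that hypercontractivity controls.\<close>
    have "(\<Sum>i<?N. \<bar>e i\<bar> * (?d i)\<^sup>2) \<le> (\<Sum>i<?N. \<bar>e i\<bar> * \<bar>cmod ((G * G) $$ (i, i))\<bar>)"
      using hermitian_square_diag[OF G] by (intro sum_mono mult_left_mono) (auto simp del: index_mult_mat(1))
    also have "\<dots> \<le> L2_set e {..<?N} * L2_set (\<lambda>i. cmod ((G * G) $$ (i, i))) {..<?N}"
      by (rule L2_set_mult_ineq)
    also have "\<dots> \<le> L2_set e {..<?N} * frob (G * G)"
    proof (intro mult_left_mono)
      have "(\<Sum>i<?N. (cmod ((G * G) $$ (i, i)))\<^sup>2) \<le> (\<Sum>i<?N. \<Sum>j<?N. (cmod ((G * G) $$ (i, j)))\<^sup>2)"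
        by (intro sum_mono member_le_sum) auto
      thus "L2_set (\<lambda>i. cmod ((G * G) $$ (i, i))) {..<?N} \<le> frob (G * G)"
        unfolding L2_set_def frob_def using G by (simp del: index_mult_mat(1))
    qed (simp add: L2_set_nonneg)
    also have "\<dots> \<le> L2_set e {..<?N} * (sqrt (2 ^ n) * S)"
      by (intro mult_left_mono GG) (simp add: L2_set_nonneg)
    finally show "(\<Sum>i<?N. \<bar>e i\<bar> * (?d i)\<^sup>2) \<le> sqrt (\<Sum>i<?N. (e i)\<^sup>2) * (sqrt (2 ^ n) * S)"
      by (simp add: L2_set_def)
  qed (simp add: sum_nonneg)
  also have "(\<Sum>i<?N. \<bar>e i\<bar>) = 2 ^ n * schatten n 1 f"
    unfolding schatten_one_diag_conj[OF U fe] by simp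
  also have "sqrt (\<Sum>i<?N. (e i)\<^sup>2) = sqrt (2 ^ n) * schatten n 2 f"
  proof -
    have "mtrace (f * f) = complex_of_real (\<Sum>i<?N. (e i)\<^sup>2)"
      by (simp add: fe diag_conj_mult[OF U] mtrace_diag_conj[OF U] power2_eq_square)
    hence "(\<Sum>i<?N. (e i)\<^sup>2) = 2 ^ n * (schatten n 2 f)\<^sup>2"
      unfolding schatten_two_power2(1)[OF f] by simp
    thus ?thesis using schatten_two_power2(2)[OF f] by (simp add: real_sqrt_mult)
  qed
  also have "2 ^ n * schatten n 1 f * (sqrt (2 ^ n) * schatten n 2 f * (sqrt (2 ^ n) * S))
     = (sqrt (2 ^ n) * sqrt (2 ^ n)) * 2 ^ n * (schatten n 1 f * schatten n 2 f) * S" by (simp only: mult_ac)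
  also have "\<dots> = (2 ^ n)\<^sup>2 * (schatten n 1 f * schatten n 2 f * S)" by (simp add: power2_eq_square)
  finally have "(2 ^ n)\<^sup>2 * (S * S) \<le> (2 ^ n)\<^sup>2 * (schatten n 1 f * schatten n 2 f * S)"
    by (simp only: power_mult_distrib power2_eq_square[of S])
  hence "S * S \<le> (schatten n 1 f * schatten n 2 f) * S" by simp
  moreover have "schatten n 1 f * schatten n 2 f \<ge> 0"
    using schatten_two_power2(2)[OF f] schatten_one_diag_conj[OF U fe] by (simp add: sum_nonneg)
  \<comment> \<open>One factor \<open>S\<close> cancels; for \<open>S = 0\<close> the claim is the
    nonnegativity of the right side.\<close>
  ultimately have "S \<le> schatten n 1 f * schatten n 2 f" using S0 by (cases "S = 0") auto
  thus ?thesis by (simp add: S_def)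
qed

section \<open>Rounding to a quantum Boolean function on fewer qubits\<close>

lemma mult_pauli_sum_commute:
  assumes L: "L \<in> carrier_mat (2 ^ n) (2 ^ n)"
    and comm: "\<And>s. s \<in> pauli_indices n \<Longrightarrow> c s \<noteq> 0 \<Longrightarrow> L * pauli_tensor s = pauli_tensor s * L"
  shows "L * pauli_sum n c = pauli_sum n c * L"
proof (rule eq_matI)
  let ?N = "2 ^ n :: nat"
  fix i j assume "i < dim_row (pauli_sum n c * L)" "j < dim_col (pauli_sum n c * L)"
  hence ij: "i < ?N" "j < ?N" using L by auto
  have "(L * pauli_sum n c) $$ (i, j) = (\<Sum>l<?N. \<Sum>s\<in>pauli_indices n. c s * (L $$ (i, l) * pauli_tensor s $$ (l, j)))"
    unfolding mult_index[OF L pauli_sum_carrier(1) ij]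
    by (intro sum.cong refl) (simp add: pauli_sum_index ij sum_distrib_left mult_ac)
  also have "\<dots> = (\<Sum>s\<in>pauli_indices n. c s * (L * pauli_tensor s) $$ (i, j))"
    by (subst sum.swap, intro sum.cong refl) (simp only: mult_index[OF L pauli_tensor_carrier ij] sum_distrib_left)
  also have "\<dots> = (\<Sum>s\<in>pauli_indices n. c s * (pauli_tensor s * L) $$ (i, j))"
    using comm by (intro sum.cong refl) (metis mult_eq_0_iff)
  also have "\<dots> = (\<Sum>l<?N. \<Sum>s\<in>pauli_indices n. c s * (pauli_tensor s $$ (i, l) * L $$ (l, j)))"
    by (subst sum.swap, intro sum.cong refl) (simp only: mult_index[OF pauli_tensor_carrier L ij] sum_distrib_left)
  also have "\<dots> = (pauli_sum n c * L) $$ (i, j)"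
    unfolding mult_index[OF pauli_sum_carrier(1) L ij]
    by (intro sum.cong refl) (simp add: pauli_sum_index ij sum_distrib_right mult.assoc)
  finally show "(L * pauli_sum n c) $$ (i, j) = (pauli_sum n c * L) $$ (i, j)" .
qed (use L in auto)

text \<open>Conjugating by a probe \<open>L\<close> that anticommutes with the string but commutes
  with \<open>C\<close> preserves the trace of their product and flips its sign.\<close>

lemma pauli_inner_eq_0:
  assumes C: "C \<in> carrier_mat (2 ^ n) (2 ^ n)" and j: "1 \<le> j" "j \<le> n"
    and comm: "\<And>k. k \<le> 3 \<Longrightarrow> local_pauli n j k * C = C * local_pauli n j k"
    and s: "s \<in> pauli_indices n" "s ! (j - 1) \<noteq> 0"
  shows "pauli_inner n C s = 0"
proof -
  let ?N = "2 ^ n :: nat"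
  \<comment> \<open>Any nonzero Pauli index different from the entry of \<open>s\<close> at qubit
    \<open>j\<close> anticommutes with it.\<close>
  define k :: nat where "k = (if s ! (j - 1) = 1 then 2 else 1)"
  define L where "L = local_pauli n j k"
  have k: "k \<le> 3" "k \<noteq> 0" "s ! (j - 1) \<noteq> k" by (auto simp: k_def)
  have L: "L \<in> carrier_mat ?N ?N" "L * L = 1\<^sub>m ?N" unfolding L_def using local_pauli[OF j] by auto
  have LC: "L * C = C * L" unfolding L_def by (rule comm[OF k(1)])
  have P: "pauli_tensor s \<in> carrier_mat ?N ?N" using s by simp
  have LP: "L * pauli_tensor s = (- 1) \<cdot>\<^sub>m (pauli_tensor s * L)"
    using local_pauli_commute[OF s(1) j k(1)] k s(2) by (simp add: L_def)
  let ?X = "pauli_tensor s * C"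
  have X: "?X \<in> carrier_mat ?N ?N" using P C by (rule mult_square)
  have "mtrace ?X = mtrace (?X * L * L)"
    using X L by (simp add: mult_square[of _ ?N] right_mult_one_mat[OF X])
  also have "\<dots> = mtrace (L * (?X * L))"
    by (rule mtrace_comm[of _ ?N ?N]) (use X L in \<open>auto intro: mult_square(1)\<close>)
  also have "L * (?X * L) = (L * pauli_tensor s) * (C * L)"
    using L P C by (simp add: mult_square[of _ ?N])
  also have "\<dots> = (- 1) \<cdot>\<^sub>m (pauli_tensor s * L * (L * C))"
    unfolding LP LC[symmetric]
    by (rule mult_smult_assoc_mat[of _ ?N ?N _ ?N]) (use L P C in \<open>auto intro: mult_square(1)\<close>)
  also have "pauli_tensor s * L * (L * C) = pauli_tensor s * ((L * L) * C)"
    using L(1) P C by (simp add: mult_square[of _ ?N])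
  also have "(L * L) * C = C" using C by (simp add: L(2))
  also have "mtrace ((- 1) \<cdot>\<^sub>m ?X) = - mtrace ?X" using X by (simp add: mtrace_smult[OF X])
  finally have "mtrace ?X = 0" by simp
  thus ?thesis by (simp add: pauli_inner_def)
qed

lemma pauli_sum_Re_pauli_inner:
  assumes "A \<in> carrier_mat (2 ^ n) (2 ^ n)" "mat_adjoint A = A"
  shows "pauli_sum n (\<lambda>s. complex_of_real (Re (pauli_inner n A s))) = A"
proof -
  have "pauli_sum n (\<lambda>s. complex_of_real (Re (pauli_inner n A s))) = pauli_sum n (pauli_inner n A)"
    by (rule pauli_sum_cong) (rule pauli_inner_real[OF assms, symmetric])
  thus ?thesis by (simp add: pauli_sum_pauli_inner[OF assms(1)])
qed

lemma boolean_rounding: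
  assumes A: "quantum_boolean n A" and T: "T \<subseteq> {1..n}"
  shows "\<exists>C. quantum_boolean n C \<and> op_supp n C \<subseteq> T \<and>
    (schatten n 2 (A - C))\<^sup>2 \<le>
      2 * (\<Sum>s\<in>{s \<in> pauli_indices n. \<not> index_supp s \<subseteq> T}. (Re (pauli_inner n A s))\<^sup>2)"
proof -
  let ?N = "2 ^ n :: nat" and ?I = "pauli_indices n"
  note A' = quantum_booleanD[OF A]
  define a where "a s = Re (pauli_inner n A s)" for s
  have Aa: "A = pauli_sum n (\<lambda>s. complex_of_real (a s))"
    unfolding a_def pauli_sum_Re_pauli_inner[OF A'(1,2)] ..
  define b where "b s = (if index_supp s \<subseteq> T then a s else 0)" for s
  define B where "B = pauli_sum n (\<lambda>s. complex_of_real (b s))"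
  have B: "B \<in> carrier_mat ?N ?N" "mat_adjoint B = B" by (simp_all add: B_def mat_adjoint_pauli_sum)
  obtain U e where U: "unitary_mat ?N U" and Be: "B = diag_conj ?N U (\<lambda>i. complex_of_real (e i))"
    using hermitian_diagonalization[OF B] by auto
  note U' = unitary_matD[OF U]
  \<comment> \<open>The value at 0 is 1 rather than 0: \<open>C\<close> must square to the identity
    on the kernel of \<open>B\<close> too.\<close>
  define sg where "sg x = complex_of_real (if x \<ge> 0 then 1 else - 1)" for x :: real
  define C where "C = diag_conj ?N U (\<lambda>i. sg (e i))"
  have "(\<lambda>i. sg (e i) * sg (e i)) = (\<lambda>_. 1)" "(\<lambda>i. cnj (sg (e i))) = (\<lambda>i. sg (e i))"
    by (auto simp: sg_def)
  hence CB: "quantum_boolean n C"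
    unfolding quantum_boolean_def C_def using U'
    by (simp add: diag_conj_adjoint diag_conj_mult[OF U] diag_conj_one[OF U])
  note C = quantum_booleanD[OF CB]
  have zero: "pauli_inner n C s = 0" if s: "s \<in> ?I" "\<not> index_supp s \<subseteq> T" for s
  proof -
    obtain j where j: "1 \<le> j" "j \<le> n" "s ! (j - 1) \<noteq> 0" "j \<notin> T"
      using s pauli_indicesD(1)[OF s(1)] by (auto simp: index_supp_def)
    show ?thesis
    proof (rule pauli_inner_eq_0[OF C(1) j(1,2) _ s(1) j(3)])
      fix k :: nat assume k: "k \<le> 3"
      have "local_pauli n j k * B = B * local_pauli n j k"
        unfolding B_def
      proof (rule mult_pauli_sum_commute[OF local_pauli_carrier[OF j(1,2)]])
        fix t assume t: "t \<in> ?I" "complex_of_real (b t) \<noteq> 0"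
        hence "index_supp t \<subseteq> T" by (auto simp: b_def split: if_splits)
        hence "t ! (j - 1) = 0" using j(1,2,4) pauli_indicesD(1)[OF t(1)] by (auto simp: index_supp_def)
        thus "local_pauli n j k * pauli_tensor t = pauli_tensor t * local_pauli n j k"
          using local_pauli_commute[OF t(1) j(1,2) k] by (auto intro!: eq_matI)
      qed
      \<comment> \<open>With both eigenbases equal, \<open>diag_conj_intertwine\<close> carries
        commutation from \<open>B\<close> to every function of \<open>B\<close>, in particular to
        its sign.\<close>
      thus "local_pauli n j k * C = C * local_pauli n j k"
        unfolding Be C_def by (rule diag_conj_intertwine[OF U U local_pauli_carrier[OF j(1,2)] inj_of_real])
    qed
  qed
  have supp: "op_supp n C \<subseteq> T"
  proof
    fix x assume "x \<in> op_supp n C"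
    then obtain s where s: "s \<in> ?I" "pauli_coeff n C s \<noteq> 0" "x \<in> index_supp s" by (auto simp: op_supp_def)
    hence "index_supp s \<subseteq> T" using zero pauli_coeff_eq[OF C(1) s(1)] by metis
    thus "x \<in> T" using s(3) by blast
  qed
  define c where "c s = Re (pauli_inner n C s)" for s
  have Cc: "C = pauli_sum n (\<lambda>s. complex_of_real (c s))"
    unfolding c_def pauli_sum_Re_pauli_inner[OF C(1,2)] ..
  have c0: "c s = 0" if "s \<in> ?I" "\<not> index_supp s \<subseteq> T" for s using zero[OF that] by (simp add: c_def)
  define \<delta> where "\<delta> = (\<Sum>s\<in>{s \<in> ?I. \<not> index_supp s \<subseteq> T}. (a s)\<^sup>2)"
  have tot: "(\<Sum>s\<in>?I. (a s)\<^sup>2) = 1"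
  proof -
    have "mtrace (A * A) = 2 ^ n * complex_of_real (\<Sum>s\<in>?I. (a s)\<^sup>2)"
      by (subst (1 2) Aa) (simp add: mtrace_pauli_sum_mult power2_eq_square)
    hence "complex_of_real (\<Sum>s\<in>?I. (a s)\<^sup>2) = 1" by (simp add: A'(3) mtrace_one)
    thus ?thesis by (simp only: of_real_eq_1_iff)
  qed
  \<comment> \<open>The coefficients of \<open>A\<close> have total mass 1, and \<open>b\<close>
    either agrees with \<open>a\<close> or vanishes, so the retained mass is the pairing of
    \<open>B\<close> with \<open>A\<close>.\<close>
  have "1 - \<delta> = (\<Sum>s\<in>?I. b s * a s)"
  proof -
    have "(\<Sum>s\<in>?I. (a s)\<^sup>2) = (\<Sum>s\<in>?I. b s * a s + (if \<not> index_supp s \<subseteq> T then (a s)\<^sup>2 else 0))"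
      by (intro sum.cong) (auto simp: b_def power2_eq_square)
    also have "\<dots> = (\<Sum>s\<in>?I. b s * a s) + \<delta>"
      unfolding \<delta>_def sum.distrib by (subst sum.inter_filter) simp_all
    finally show ?thesis using tot by simp
  qed
  also have "\<dots> = Re (mtrace (B * A)) / 2 ^ n"
    unfolding B_def by (subst Aa) (simp add: mtrace_pauli_sum_mult)
  also have "\<dots> \<le> schatten n 1 B" by (rule mtrace_boolean_le[OF A B])
  also have "\<dots> = Re (mtrace (B * C)) / 2 ^ n"
  proof -
    have "complex_of_real (e i) * sg (e i) = complex_of_real \<bar>e i\<bar>" for i
      by (auto simp: sg_def)
    hence "mtrace (B * C) = complex_of_real (\<Sum>i<?N. \<bar>e i\<bar>)"
      unfolding Be C_def diag_conj_mult[OF U] mtrace_diag_conj[OF U] by simp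
    thus ?thesis unfolding schatten_one_diag_conj[OF U Be] by simp
  qed
  \<comment> \<open>\<open>C\<close> has no strings outside \<open>T\<close>, so the part of
    \<open>A\<close> that was cut off is orthogonal to it.\<close>
  also have "mtrace (B * C) = mtrace (A * C)"
  proof -
    have "(\<Sum>s\<in>?I. complex_of_real (b s) * complex_of_real (c s)) = (\<Sum>s\<in>?I. complex_of_real (a s) * complex_of_real (c s))"
      using c0 by (intro sum.cong) (auto simp: b_def)
    thus ?thesis unfolding B_def by (subst (1 2) Cc, subst Aa) (simp add: mtrace_pauli_sum_mult)
  qed
  finally have AC: "1 - \<delta> \<le> Re (mtrace (A * C)) / 2 ^ n" .
  have AmC: "A - C \<in> carrier_mat ?N ?N" "mat_adjoint (A - C) = A - C"
    using A' C by (simp_all add: mat_adjoint_minus[OF A'(1) C(1)] minus_carrier_mat)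
  \<comment> \<open>Since \<open>A\<close> and \<open>C\<close> both square to the identity, their
    distance depends only on the trace of \<open>A * C\<close>.\<close>
  have "mtrace ((A - C) * (A - C)) = mtrace (A * A) - mtrace (C * A) - (mtrace (A * C) - mtrace (C * C))"
    using A'(1) C(1)
    by (simp add: mult_minus_distrib_mat[OF AmC(1)] minus_mult_distrib_mat[of _ ?N ?N] mtrace_minus[of _ ?N] mult_square[of _ ?N] minus_carrier_mat)
  also have "\<dots> = 2 * 2 ^ n - 2 * mtrace (A * C)"
    using mtrace_comm[OF C(1) A'(1)] by (simp add: A'(3) C(3) mtrace_one)
  finally have "Re (mtrace ((A - C) * (A - C))) = Re (2 * 2 ^ n - 2 * mtrace (A * C))" by (rule arg_cong)
  also have "\<dots> = 2 * 2 ^ n - 2 * Re (mtrace (A * C))"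
  proof -
    have "(2 * 2 ^ n :: complex) = complex_of_real (2 * 2 ^ n)" by simp
    hence "Re (2 * 2 ^ n) = 2 * 2 ^ n" by (simp only: Re_complex_of_real)
    moreover have "Re (2 * z) = 2 * Re z" for z by simp
    ultimately show ?thesis by (simp only: minus_complex.sel(1))
  qed
  finally have "(schatten n 2 (A - C))\<^sup>2 = 2 - 2 * (Re (mtrace (A * C)) / 2 ^ n)"
    unfolding schatten_two_power2(1)[OF AmC] by (simp add: field_simps)
  also have "\<dots> \<le> 2 * \<delta>" using AC by simp
  finally show ?thesis using CB supp unfolding \<delta>_def a_def by blast
qed

section \<open>Friedgut's argument\<close>

lemma card_index_supp: "card (index_supp s) = pauli_weight s"
proof -
  have "index_supp s = Suc ` {i. i < length s \<and> s ! i \<noteq> 0}"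
  proof (intro equalityI subsetI)
    fix j assume "j \<in> index_supp s"
    thus "j \<in> Suc ` {i. i < length s \<and> s ! i \<noteq> 0}"
      by (intro image_eqI[of _ _ "j - 1"]) (auto simp: index_supp_def)
  qed (auto simp: index_supp_def)
  thus ?thesis
    by (simp add: card_image pauli_weight_def length_filter_conv_card)
qed

lemma index_supp_pauli_indices:
  "s \<in> pauli_indices n \<Longrightarrow> index_supp s = {j \<in> {1..n}. s ! (j - 1) \<noteq> 0}"
  using pauli_indicesD(1)[of s n] by (auto simp: index_supp_def)

lemma schatten_one_nonneg:
  assumes "f \<in> carrier_mat (2 ^ n) (2 ^ n)" "mat_adjoint f = f"
  shows "schatten n 1 f \<ge> 0"
proof -
  obtain U e where "unitary_mat (2 ^ n) U" "f = diag_conj (2 ^ n) U (\<lambda>i. complex_of_real (e i))"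
    using hermitian_diagonalization[OF assms] by auto
  thus ?thesis using schatten_one_diag_conj by (simp add: sum_nonneg)
qed

lemma boolean_influences:
  assumes A: "quantum_boolean n A"
  defines "a \<equiv> \<lambda>s. Re (pauli_inner n A s)"
  assumes j: "j \<in> {1..n}"
  defines "f \<equiv> qubit_diff n j A"
  shows influence_at_one: "influence_at n 1 j A = schatten n 1 f"
    and influence_at_two: "influence_at n 2 j A = (schatten n 2 f)\<^sup>2"
    and influence_at_two_sum: "influence_at n 2 j A = (\<Sum>s\<in>pauli_indices n. if s ! (j - 1) = 0 then 0 else (a s)\<^sup>2)"
    and influence_at_two_le: "influence_at n 2 j A \<le> influence_at n 1 j A"
    and influence_at_nonneg: "influence_at n 1 j A \<ge> 0"
    and damped_weight_le_influences: "(\<Sum>s\<in>pauli_indices n. if s ! (j - 1) = 0 then 0 else (a s)\<^sup>2 / 16 ^ pauli_weight s)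
      \<le> influence_at n 1 j A * sqrt (influence_at n 2 j A)"
proof -
  note A' = quantum_booleanD[OF A]
  define c where "c s = (if s ! (j - 1) = 0 then 0 else a s)" for s
  have Aa: "A = pauli_sum n (\<lambda>s. complex_of_real (a s))"
    unfolding a_def pauli_sum_Re_pauli_inner[OF A'(1,2)] ..
  have fc: "f = pauli_sum n (\<lambda>s. complex_of_real (c s))"
    unfolding f_def by (subst Aa, subst qubit_diff_pauli_sum) (use j in \<open>auto simp: c_def intro!: pauli_sum_cong\<close>)
  have f: "f \<in> carrier_mat (2 ^ n) (2 ^ n)" "mat_adjoint f = f" by (simp_all add: fc mat_adjoint_pauli_sum)
  note s1 = schatten_one_nonneg[OF f] and s2 = schatten_two_power2(2)[OF f]
  show i1: "influence_at n 1 j A = schatten n 1 f" using s1 by (simp add: influence_at_def f_def)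
  show i2: "influence_at n 2 j A = (schatten n 2 f)\<^sup>2" using s2 by (simp add: influence_at_def f_def)
  show "influence_at n 1 j A \<ge> 0" using s1 i1 by simp
  show sum: "influence_at n 2 j A = (\<Sum>s\<in>pauli_indices n. if s ! (j - 1) = 0 then 0 else (a s)\<^sup>2)"
    unfolding i2 fc schatten_two_pauli_sum by (intro sum.cong) (auto simp: c_def)
  \<comment> \<open>\<open>f\<close> is an orthogonal projection of \<open>A\<close>, so its squared
    2-norm is its pairing with \<open>A\<close>, and duality bounds this by the 1-norm. This is
    where Inf^2 \<le> Inf^1 comes from.\<close>
  have "influence_at n 2 j A = (\<Sum>s\<in>pauli_indices n. c s * a s)"
    unfolding sum by (intro sum.cong) (auto simp: c_def power2_eq_square)
  also have "\<dots> = Re (mtrace (f * A)) / 2 ^ n"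
    unfolding fc by (subst Aa) (simp add: mtrace_pauli_sum_mult)
  also have "\<dots> \<le> influence_at n 1 j A" unfolding i1 by (rule mtrace_boolean_le[OF A f])
  finally show "influence_at n 2 j A \<le> influence_at n 1 j A" .
  have "(\<Sum>s\<in>pauli_indices n. if s ! (j - 1) = 0 then 0 else (a s)\<^sup>2 / 16 ^ pauli_weight s)
     = (\<Sum>s\<in>pauli_indices n. (c s)\<^sup>2 / 16 ^ pauli_weight s)"
    by (intro sum.cong) (auto simp: c_def)
  also have "\<dots> \<le> schatten n 1 f * schatten n 2 f" unfolding fc by (rule damped_weight_le)
  finally show "(\<Sum>s\<in>pauli_indices n. if s ! (j - 1) = 0 then 0 else (a s)\<^sup>2 / 16 ^ pauli_weight s)
      \<le> influence_at n 1 j A * sqrt (influence_at n 2 j A)"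
    unfolding i1 i2 using s2 by simp
qed

lemma influence_nonneg:
  assumes "quantum_boolean n A"
  shows "0 \<le> influence n 2 A" "influence n 2 A \<le> influence n 1 A"
  unfolding influence_def
  using influence_at_two[OF assms] influence_at_two_le[OF assms] by (auto intro!: sum_nonneg sum_mono)

text \<open>Double counting: a string contributes its mass once for each qubit in its
  support.\<close>

lemma influence_two_eq:
  assumes "quantum_boolean n A"
  shows "influence n 2 A = (\<Sum>s\<in>pauli_indices n. real (pauli_weight s) * (Re (pauli_inner n A s))\<^sup>2)"
proof -
  have "influence n 2 A = (\<Sum>j=1..n. \<Sum>s\<in>pauli_indices n. if s ! (j - 1) = 0 then 0 else (Re (pauli_inner n A s))\<^sup>2)"
    unfolding influence_def by (intro sum.cong refl influence_at_two_sum[OF assms])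
  also have "\<dots> = (\<Sum>s\<in>pauli_indices n. \<Sum>j=1..n. if s ! (j - 1) = 0 then 0 else (Re (pauli_inner n A s))\<^sup>2)"
    by (rule sum.swap)
  also have "\<dots> = (\<Sum>s\<in>pauli_indices n. real (pauli_weight s) * (Re (pauli_inner n A s))\<^sup>2)"
  proof (intro sum.cong refl)
    fix s assume s: "s \<in> pauli_indices n"
    let ?x = "(Re (pauli_inner n A s))\<^sup>2"
    have "(\<Sum>j=1..n. if s ! (j - 1) = 0 then 0 else ?x) = (\<Sum>j\<in>{1..n}. if s ! (j - 1) \<noteq> 0 then ?x else 0)"
      by (intro sum.cong) auto
    also have "\<dots> = (\<Sum>j\<in>index_supp s. ?x)"
      unfolding index_supp_pauli_indices[OF s] by (subst sum.inter_filter) simp_all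
    finally show "(\<Sum>j=1..n. if s ! (j - 1) = 0 then 0 else ?x) = real (pauli_weight s) * ?x"
      by (simp add: card_index_supp)
  qed
  finally show ?thesis .
qed

text \<open>The cutoff \<open>d\<close> is real, hence the \<open>powr\<close>, so that it can later
  be chosen proportional to Inf^2 / \<epsilon>^2 without rounding.\<close>

lemma friedgut_tail:
  assumes A: "quantum_boolean n A" and d: "d > 0" and \<tau>: "\<tau> \<ge> 0"
  defines "T \<equiv> {j \<in> {1..n}. influence_at n 1 j A \<ge> \<tau>}"
  shows "(\<Sum>s\<in>{s \<in> pauli_indices n. \<not> index_supp s \<subseteq> T}. (Re (pauli_inner n A s))\<^sup>2)
    \<le> influence n 2 A / d + 16 powr d * sqrt (\<tau> * influence n 1 A * influence n 2 A)"
proof -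
  let ?I = "pauli_indices n" and ?J = "{1..n} - T"
  define a where "a s = Re (pauli_inner n A s)" for s
  define p where "p j = influence_at n 1 j A" for j
  define q where "q j = influence_at n 2 j A" for j
  define h where "h s j = (if s ! (j - 1) = 0 then 0 else (a s)\<^sup>2 / 16 ^ pauli_weight s)" for s j
  have h0: "h s j \<ge> 0" for s j by (simp add: h_def)
  have p0: "p j \<ge> 0" and q0: "q j \<ge> 0" if "j \<in> {1..n}" for j
    using influence_at_nonneg[OF A that] influence_at_two[OF A that] by (simp_all add: p_def q_def)
  \<comment> \<open>One bound serves both kinds of string: a heavy one is paid for by the first
    summand, since its weight exceeds \<open>d\<close>, and a light one by the term
    \<open>h s j\<close> of a single qubit \<open>j\<close> in its support outside
    \<open>T\<close>.\<close>
  have bound: "(a s)\<^sup>2 \<le> real (pauli_weight s) * (a s)\<^sup>2 / d + 16 powr d * (\<Sum>j\<in>?J. h s j)"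
    if s: "s \<in> ?I" "\<not> index_supp s \<subseteq> T" for s
  proof (cases "real (pauli_weight s) > d")
    case True
    hence "1 * (a s)\<^sup>2 \<le> (real (pauli_weight s) / d) * (a s)\<^sup>2" using d by (intro mult_right_mono) auto
    moreover have "0 \<le> 16 powr d * (\<Sum>j\<in>?J. h s j)" by (intro mult_nonneg_nonneg sum_nonneg h0) auto
    ultimately show ?thesis by simp
  next
    case False
    obtain j where j: "j \<in> ?J" "s ! (j - 1) \<noteq> 0" using s index_supp_pauli_indices[OF s(1)] by auto
    have "16 ^ pauli_weight s \<le> 16 powr d"
      using False by (subst powr_realpow[symmetric]) auto
    hence "16 ^ pauli_weight s * h s j \<le> 16 powr d * (\<Sum>j\<in>?J. h s j)"
      using j by (intro mult_mono member_le_sum h0) auto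
    moreover have "16 ^ pauli_weight s * h s j = (a s)\<^sup>2" using j by (simp add: h_def)
    moreover have "0 \<le> real (pauli_weight s) * (a s)\<^sup>2 / d" using d by simp
    ultimately show ?thesis by linarith
  qed
  \<comment> \<open>Summed over qubits outside \<open>T\<close>, the terms
    \<open>p j * sqrt (q j)\<close> are split by Cauchy-Schwarz; \<open>p j < \<tau>\<close> there
    turns the sum of squares of \<open>p\<close> into \<tau> times Inf^1.\<close>
  have low: "(\<Sum>s\<in>?I. \<Sum>j\<in>?J. h s j) \<le> sqrt (\<tau> * influence n 1 A * influence n 2 A)"
  proof -
    have "(\<Sum>s\<in>?I. \<Sum>j\<in>?J. h s j) = (\<Sum>j\<in>?J. \<Sum>s\<in>?I. h s j)" by (rule sum.swap)
    also have "\<dots> \<le> (\<Sum>j\<in>?J. \<bar>p j\<bar> * \<bar>sqrt (q j)\<bar>)"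
      unfolding h_def a_def using damped_weight_le_influences[OF A] p0 q0
      by (intro sum_mono) (simp add: p_def q_def del: One_nat_def)
    also have "\<dots> \<le> L2_set p ?J * L2_set (\<lambda>j. sqrt (q j)) ?J" by (rule L2_set_mult_ineq)
    also have "\<dots> \<le> sqrt (\<tau> * influence n 1 A) * sqrt (influence n 2 A)"
    proof (rule mult_mono)
      have "(\<Sum>j\<in>?J. (p j)\<^sup>2) \<le> (\<Sum>j\<in>?J. \<tau> * p j)"
        unfolding power2_eq_square using p0 by (intro sum_mono mult_right_mono) (auto simp: T_def p_def)
      also have "\<dots> \<le> (\<Sum>j=1..n. \<tau> * p j)" using p0 \<tau> by (intro sum_mono2) auto
      also have "\<dots> = \<tau> * influence n 1 A" by (simp add: influence_def p_def sum_distrib_left)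
      finally show "L2_set p ?J \<le> sqrt (\<tau> * influence n 1 A)" by (simp add: L2_set_def)
      have "(\<Sum>j\<in>?J. (sqrt (q j))\<^sup>2) = (\<Sum>j\<in>?J. q j)" using q0 by (intro sum.cong) auto
      also have "\<dots> \<le> (\<Sum>j=1..n. q j)" using q0 by (intro sum_mono2) auto
      finally show "L2_set (\<lambda>j. sqrt (q j)) ?J \<le> sqrt (influence n 2 A)"
        by (simp add: L2_set_def influence_def q_def)
    qed (use \<tau> influence_nonneg[OF A] in \<open>auto simp: L2_set_nonneg\<close>)
    finally show ?thesis by (simp add: real_sqrt_mult)
  qed
  have nonneg: "0 \<le> real (pauli_weight s) * (a s)\<^sup>2 / d + 16 powr d * (\<Sum>j\<in>?J. h s j)" for s
    using d by (intro add_nonneg_nonneg mult_nonneg_nonneg sum_nonneg h0) auto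
  have "(\<Sum>s\<in>{s \<in> ?I. \<not> index_supp s \<subseteq> T}. (a s)\<^sup>2) \<le>
    (\<Sum>s\<in>{s \<in> ?I. \<not> index_supp s \<subseteq> T}. real (pauli_weight s) * (a s)\<^sup>2 / d + 16 powr d * (\<Sum>j\<in>?J. h s j))"
    using bound by (intro sum_mono) auto
  also have "\<dots> \<le> (\<Sum>s\<in>?I. real (pauli_weight s) * (a s)\<^sup>2 / d + 16 powr d * (\<Sum>j\<in>?J. h s j))"
    using nonneg by (intro sum_mono2) auto
  also have "\<dots> = influence n 2 A / d + 16 powr d * (\<Sum>s\<in>?I. \<Sum>j\<in>?J. h s j)"
    by (simp add: sum.distrib influence_two_eq[OF A] a_def sum_divide_distrib sum_distrib_left)
  also have "\<dots> \<le> influence n 2 A / d + 16 powr d * sqrt (\<tau> * influence n 1 A * influence n 2 A)"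
    by (intro add_left_mono mult_left_mono low) simp
  finally show ?thesis by (simp add: a_def)
qed

section \<open>From the tail estimate to a junta, and the choice of parameters\<close>

lemma boolean_junta:
  assumes A: "quantum_boolean n A" and T: "T \<subseteq> {1..n}" and \<epsilon>: "\<epsilon> > 0"
    and tail: "(\<Sum>s\<in>{s \<in> pauli_indices n. \<not> index_supp s \<subseteq> T}. (Re (pauli_inner n A s))\<^sup>2) \<le> \<epsilon>\<^sup>2 / 2"
  shows "\<exists>C. quantum_boolean n C \<and> junta n (card T) C \<and> schatten n 2 (A - C) \<le> \<epsilon>"
proof -
  obtain C where C: "quantum_boolean n C" "op_supp n C \<subseteq> T"
    and AC: "(schatten n 2 (A - C))\<^sup>2 \<le> 2 * (\<Sum>s\<in>{s \<in> pauli_indices n. \<not> index_supp s \<subseteq> T}. (Re (pauli_inner n A s))\<^sup>2)"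
    using boolean_rounding[OF A T] by blast
  have "card (op_supp n C) \<le> card T" by (rule card_mono[OF finite_subset[OF T] C(2)]) simp
  hence "junta n (card T) C" using quantum_booleanD(1)[OF C(1)] by (simp add: junta_def)
  moreover have "(schatten n 2 (A - C))\<^sup>2 \<le> \<epsilon>\<^sup>2" using AC tail by simp
  hence "schatten n 2 (A - C) \<le> \<epsilon>" by (rule power2_le_imp_le) (use \<epsilon> in simp)
  ultimately show ?thesis using C(1) by (intro exI[of _ C] conjI)
qed

text \<open>The square of \<open>16 powr (4 * x)\<close> is \<open>2 powr (32 * x)\<close>, and
  \<open>16 * x\<^sup>2\<close> is at most \<open>2 powr (16 * x)\<close> because
  \<open>4 * x \<le> 2 powr (8 * x)\<close>. Thus the exponent reached is
  \<open>48 * x\<close>.\<close>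

lemma exponent_slack:
  fixes x :: real
  assumes "x \<ge> 0"
  shows "16 * (16 powr (4 * x))\<^sup>2 * x\<^sup>2 \<le> 2 powr (270 * x)"
proof -
  have "ln 2 \<ge> (1 / 2 :: real)" using ln_mono[OF exp_half_le2] by simp
  hence "8 * x * (1 / 2) \<le> 8 * x * ln 2" using assms by (intro mult_left_mono) auto
  hence "4 * x \<le> 1 + 8 * x * ln 2" by simp
  also have "\<dots> \<le> 2 powr (8 * x)" unfolding powr_def by (simp add: exp_ge_add_one_self)
  finally have "(4 * x)\<^sup>2 \<le> (2 powr (8 * x))\<^sup>2" using assms by (intro power_mono) auto
  also have "\<dots> = 2 powr (16 * x)" by (simp add: power2_eq_square powr_add[symmetric])
  finally have x: "16 * x\<^sup>2 \<le> 2 powr (16 * x)" by (simp add: power_mult_distrib)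
  have "(16 :: real) powr (4 * x) = 2 powr (16 * x)"
    using powr_powr[of 2 4 "4 * x"] by simp
  hence "(16 powr (4 * x))\<^sup>2 = 2 powr (32 * x)" by (simp add: power2_eq_square powr_add[symmetric])
  hence "16 * (16 powr (4 * x))\<^sup>2 * x\<^sup>2 = (16 * x\<^sup>2) * 2 powr (32 * x)" by simp
  also have "\<dots> \<le> 2 powr (16 * x) * 2 powr (32 * x)" using x by (intro mult_right_mono) auto
  also have "\<dots> = 2 powr (48 * x)" by (simp add: powr_add[symmetric])
  also have "\<dots> \<le> 2 powr (270 * x)" using assms by simp
  finally show ?thesis .
qed

theorem corollary3p12:
  "\<exists>\<epsilon>\<^sub>0::real > 0. \<forall>(n::nat) (A::complex mat) (\<epsilon>::real).
     quantum_boolean n A \<longrightarrow> 0 < \<epsilon> \<longrightarrow> \<epsilon> < \<epsilon>\<^sub>0 \<longrightarrow>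
     (\<exists>(C::complex mat) (k::nat). quantum_boolean n C \<and> junta n k C \<and> schatten n 2 (A - C) \<le> \<epsilon> \<and>
        real k \<le> 2 powr (270 * influence n 2 A / \<epsilon>\<^sup>2) * (influence n 1 A ^ 6 / influence n 2 A ^ 5))"
proof (rule exI[of _ 1], intro conjI allI impI)
  fix n :: nat and A :: "complex mat" and \<epsilon> :: real
  assume A: "quantum_boolean n A" and \<epsilon>: "0 < \<epsilon>"
  define I1 where "I1 = influence n 1 A"
  define I2 where "I2 = influence n 2 A"
  have I: "0 \<le> I2" "I2 \<le> I1" unfolding I1_def I2_def by (rule influence_nonneg[OF A])+
  have "\<exists>T\<subseteq>{1..n}. (\<Sum>s\<in>{s \<in> pauli_indices n. \<not> index_supp s \<subseteq> T}. (Re (pauli_inner n A s))\<^sup>2) \<le> \<epsilon>\<^sup>2 / 2 \<and>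
    real (card T) \<le> 2 powr (270 * I2 / \<epsilon>\<^sup>2) * (I1 ^ 6 / I2 ^ 5)"
  proof (cases "2 * I2 \<le> \<epsilon>\<^sup>2")
    case True
    \<comment> \<open>Poincare inequality: every string other than the identity string has weight at
      least 1, so the whole variance is at most \<open>I2\<close>.\<close>
    have "(\<Sum>s\<in>{s \<in> pauli_indices n. \<not> index_supp s \<subseteq> {}}. (Re (pauli_inner n A s))\<^sup>2)
      \<le> (\<Sum>s\<in>{s \<in> pauli_indices n. \<not> index_supp s \<subseteq> {}}. real (pauli_weight s) * (Re (pauli_inner n A s))\<^sup>2)"
    proof (rule sum_mono)
      fix s assume "s \<in> {s \<in> pauli_indices n. \<not> index_supp s \<subseteq> {}}"
      hence "finite (index_supp s)" "index_supp s \<noteq> {}"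
        using index_supp_pauli_indices[of s n] by auto
      hence "pauli_weight s \<ge> 1"
        using card_gt_0_iff[of "index_supp s"] by (simp add: card_index_supp)
      thus "(Re (pauli_inner n A s))\<^sup>2 \<le> real (pauli_weight s) * (Re (pauli_inner n A s))\<^sup>2"
        by (simp add: mult_le_cancel_right1)
    qed
    also have "\<dots> \<le> I2" unfolding I2_def influence_two_eq[OF A] by (intro sum_mono2) auto
    \<comment> \<open>This case includes \<open>I2 = 0\<close>, where the quotient by 0 has the
      value 0 and the bound forces an empty junta; the empty set meets it.\<close>
    finally show ?thesis using True I by (intro exI[of _ "{}"]) auto
  next
    case False
    hence I2: "I2 > 0" and I1: "I1 > 0" using I \<epsilon> by (smt (verit) zero_le_power2)+
    define x where "x = I2 / \<epsilon>\<^sup>2"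
    have x: "x > 0" using I2 \<epsilon> by (simp add: x_def)
    \<comment> \<open>The weight cutoff is \<open>4 * x\<close>, so that heavy strings contribute
      \<open>I2 / (4 * x)\<close>, which is \<epsilon>^2/4.\<close>
    define M where "M = 16 powr (4 * x)"
    have M: "M > 0" by (simp add: M_def)
    \<comment> \<open>Solves \<open>M * sqrt (\<tau> * I1 * I2) = \<epsilon>\<^sup>2 / 4\<close>,
      the other half of the budget.\<close>
    define \<tau> where "\<tau> = \<epsilon> ^ 4 / (16 * M\<^sup>2 * I1 * I2)"
    have \<tau>: "\<tau> > 0" using I1 I2 \<epsilon> M by (simp add: \<tau>_def)
    define T where "T = {j \<in> {1..n}. influence_at n 1 j A \<ge> \<tau>}"
    have "(\<Sum>s\<in>{s \<in> pauli_indices n. \<not> index_supp s \<subseteq> T}. (Re (pauli_inner n A s))\<^sup>2)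
      \<le> I2 / (4 * x) + M * sqrt (\<tau> * I1 * I2)"
      unfolding T_def I1_def I2_def M_def using x \<tau> by (intro friedgut_tail[OF A]) auto
    also have "\<tau> * I1 * I2 = (\<epsilon>\<^sup>2 / (4 * M))\<^sup>2"
      using I1 I2 M by (simp add: \<tau>_def power_divide power_mult_distrib)
    also have "I2 / (4 * x) + M * sqrt \<dots> = \<epsilon>\<^sup>2 / 2"
      using M I2 \<epsilon> by (simp add: x_def)
    finally have tail: "(\<Sum>s\<in>{s \<in> pauli_indices n. \<not> index_supp s \<subseteq> T}. (Re (pauli_inner n A s))\<^sup>2) \<le> \<epsilon>\<^sup>2 / 2" .
    \<comment> \<open>Markov's inequality: each qubit in \<open>T\<close> accounts for at least
      \<tau> of the total 1-influence.\<close>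
    have "real (card T) * \<tau> = (\<Sum>j\<in>T. \<tau>)" by simp
    also have "\<dots> \<le> (\<Sum>j\<in>T. influence_at n 1 j A)" by (intro sum_mono) (simp add: T_def)
    also have "\<dots> \<le> I1" unfolding I1_def influence_def
      using influence_at_nonneg[OF A] by (intro sum_mono2) (auto simp: T_def)
    finally have "real (card T) \<le> I1 / \<tau>" using \<tau> by (simp add: pos_le_divide_eq)
    also have "\<dots> = (16 * M\<^sup>2 * x\<^sup>2) * (I1\<^sup>2 / I2)"
    proof -
      have "x\<^sup>2 = I2\<^sup>2 / \<epsilon> ^ 4" by (simp add: x_def power_divide)
      thus ?thesis using I1 I2 \<epsilon> M by (simp add: \<tau>_def power2_eq_square)
    qed
    also have "\<dots> \<le> 2 powr (270 * x) * (I1 ^ 6 / I2 ^ 5)"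
    proof (rule mult_mono)
      show "16 * M\<^sup>2 * x\<^sup>2 \<le> 2 powr (270 * x)" unfolding M_def using x by (intro exponent_slack) simp
      \<comment> \<open>The count produces the smaller quotient \<open>I1\<^sup>2 / I2\<close>;
        multiplying it by the fourth power of \<open>I1 / I2\<close>, which is at least 1, gives the
        stated form.\<close>
      have "I1\<^sup>2 / I2 = I1\<^sup>2 * I2 ^ 4 / I2 ^ 5" using I2 by (simp add: field_simps eval_nat_numeral)
      also have "\<dots> \<le> I1\<^sup>2 * I1 ^ 4 / I2 ^ 5"
        using I I2 by (intro divide_right_mono mult_left_mono power_mono) auto
      finally show "I1\<^sup>2 / I2 \<le> I1 ^ 6 / I2 ^ 5" by (simp add: power_add[symmetric])
    qed (use I1 I2 in auto)
    finally show ?thesis using tail by (intro exI[of _ T]) (auto simp: T_def x_def)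
  qed
  then obtain T where T: "T \<subseteq> {1..n}"
    "(\<Sum>s\<in>{s \<in> pauli_indices n. \<not> index_supp s \<subseteq> T}. (Re (pauli_inner n A s))\<^sup>2) \<le> \<epsilon>\<^sup>2 / 2"
    "real (card T) \<le> 2 powr (270 * I2 / \<epsilon>\<^sup>2) * (I1 ^ 6 / I2 ^ 5)" by blast
  show "\<exists>C k. quantum_boolean n C \<and> junta n k C \<and> schatten n 2 (A - C) \<le> \<epsilon> \<and>
      real k \<le> 2 powr (270 * influence n 2 A / \<epsilon>\<^sup>2) * (influence n 1 A ^ 6 / influence n 2 A ^ 5)"
    using boolean_junta[OF A T(1) \<epsilon> T(2)] T(3) unfolding I1_def I2_def by blast
qed simp

end
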